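(* Let $R$ be a commutative ring and let $\nu$ be a unitary equivalence relation on the index set $I$ such that all equivalence classes of $\nu$ contain at least 3 elements. Let $(\sigma,\Gamma)$ be an exact form net of ideals over $R$ such that $[\nu]_R\le(\sigma,\Gamma)$. Then the normalizer $\mathrm{N}_{\mathrm{Sp}(2n,R)}(\mathrm{Sp}(\sigma,\Gamma))$ coincides with the transporter $$\mathrm{Transp}_{\mathrm{Sp}(2n,R)}(\mathrm{Ep}(\sigma,\Gamma),\mathrm{Sp}(\sigma,\Gamma))=\{a\in\mathrm{Sp}(2n,R): a\tau a^{-1}\in\mathrm{Sp}(\sigma,\Gamma)\ \text{for all}\ \tau\in\mathrm{Ep}(\sigma,\Gamma)\},$$ and consists precisely of all matrices $a\in\mathrm{Sp}(2n,R)$ such that the following three properties hold: (T1) $a_{ij}\,\sigma_{jk}\,a'_{kl}\subseteq\sigma_{il}$ for all $i,j,k,l\in I$; (T2) $a_{ij}^2\,\xi^2\,S_{k,-k}(a^{-1})\in\Gamma_i$ for all $i,j,k\in I$ and all $\xi\in\sigma_{jk}$; (T3) $a_{ij}^2\,\Gamma_j\subseteq\Gamma_i$ for all $i,j\in I$.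
   Context: Rings are associative and unital. Fix a natural number $n$. Rows and columns of $2n\times 2n$ matrices are indexed by $I=\{1,\dots,n,-n,\dots,-1\}$; $\varepsilon_i=+1$ if $i>0$ and $\varepsilon_i=-1$ if $i<0$. For an invertible matrix $a$, $a_{ij}$ is its $(i,j)$ entry and $a'_{ij}$ the $(i,j)$ entry of $a^{-1}$; $e$ is the identity matrix and $e_{ij}$ are the matrix units. For a commutative ring $R$, $\mathrm{Sp}(2n,R)$ is the group of all $a\in\mathrm{GL}(2n,R)$ with $a'_{ij}=\varepsilon_i\varepsilon_j a_{-j,-i}$ for all $i,j\in I$. For $\xi\in R$ the long transvections are $T_{i,-i}(\xi)=e+\xi e_{i,-i}$ ($i\in I$), and the short transvections are $T_{ij}(\xi)=e+\xi e_{ij}-\varepsilon_i\varepsilon_j\xi e_{-j,-i}$ ($i\neq\pm j$). An equivalence relation $\nu$ (written $\sim$) on $I$ is unitary if $i\sim j$ implies $-i\sim -j$. A net of ideals over $R$ is an array $\sigma=(\sigma_{ij})_{i,j\in I}$ of ideals of $R$ with $\sigma_{ik}\sigma_{kj}\le\sigma_{ij}$ for all $i,j,k$. It is unitary if $\sigma_{ij}=\sigma_{-j,-i}$ for all $i,j$, and a D-net if $\sigma_{ii}=R$ for all $i$. A form net of ideals is a pair $(\sigma,\Gamma)$, where $\sigma$ is a net of ideals and $\Gamma=(\Gamma_i)_{i\in I}$ is a family of additive subgroups of $R$ such that $2\sigma_{i,-i}\le\Gamma_i\le\sigma_{i,-i}$ and $\xi^2\alpha\in\Gamma_i$ for all $i,j\in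 I$, $\xi\in\sigma_{ij}$, $\alpha\in\Gamma_j$. It is exact if $\sigma_{i,-i}=\sum_{k\neq\pm i}\sigma_{ik}\sigma_{k,-i}+\langle\Gamma_i\rangle$ for all $i$ ($\langle\Gamma_i\rangle$ is the ideal generated by $\Gamma_i$). Convention: all form nets are unitary exact form D-nets. Write $(\sigma',\Gamma')\le(\sigma'',\Gamma'')$ if $\sigma'_{ij}\le\sigma''_{ij}$ and $\Gamma'_i\le\Gamma''_i$ for all $i,j$. The form net $[\nu]_R=(\sigma_\nu,\Gamma_\nu)$ has $(\sigma_\nu)_{ij}=R$ if $i\sim j$ and $0$ otherwise, and $(\Gamma_\nu)_i=R$ if $i\sim -i$ and $0$ otherwise. $\mathrm{Ep}(\sigma,\Gamma)=\langle T_{ij}(\xi),T_{i,-i}(\alpha): i\neq\pm j,\ \xi\in\sigma_{ij},\ \alpha\in\Gamma_i\rangle$. For $g\in\mathrm{Sp}(2n,R)$ put $S_{i,-i}(g)=\sum_{j>0}g_{ij}g'_{j,-i}$, and $\mathrm{Sp}(\sigma,\Gamma)=\{g\in\mathrm{Sp}(2n,R): g_{ij}\in\sigma_{ij},\ S_{i,-i}(g)\in\Gamma_i\ \forall i,j\in I\}$, which is a subgroup of $\mathrm{Sp}(2n,R)$. *)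

theory Defs
  imports
    "HOL-Analysis.Analysis"
    "HOL-Library.Set_Algebras"
    "HOL-Algebra.Group_Action"
    "HOL-Algebra.Generated_Groups"
begin

section \<open>The index set\<close>

text \<open>
  The index set \<open>{1, \<dots>, n, -n, \<dots>, -1}\<close>: the number \<open>n\<close> is the cardinality of
  the type argument, \<open>Pos k\<close> stands for the index \<open>k\<close> and \<open>Neg k\<close> for \<open>-k\<close>.
\<close>

datatype 'n idx = Pos 'n | Neg 'n

instance idx :: (finite) finite
proof
  have "x \<in> range Pos \<union> range Neg" for x :: "'a idx"
    by (cases x) simp_all
  then have "(UNIV :: 'a idx set) = range Pos \<union> range Neg"
    by auto
  then show "finite (UNIV :: 'a idx set)"
    by (metis finite_Un finite_imageI finite)
qed

instantiation idx :: (type) uminus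
begin

primrec uminus_idx :: "'a idx \<Rightarrow> 'a idx" where
  "- Pos k = Neg k"
| "- Neg k = Pos k"

instance ..

end

primrec eps :: "'n idx \<Rightarrow> 'r::comm_ring_1" where
  "eps (Pos k) = 1"
| "eps (Neg k) = - 1"

definition unitary_rel :: "('n idx \<times> 'n idx) set \<Rightarrow> bool" where
  "unitary_rel \<nu> \<longleftrightarrow> (\<forall>i j. (i, j) \<in> \<nu> \<longrightarrow> (- i, - j) \<in> \<nu>)"

section \<open>The symplectic group\<close>

type_synonym ('r, 'n) sqmat = "'r ^ 'n idx ^ 'n idx"

definition Sp_carrier :: "('r::comm_ring_1, 'n::finite) sqmat set" where
  "Sp_carrier = {a. invertible a \<and>
     (\<forall>i j. matrix_inv a $ i $ j = eps i * eps j * a $ (- j) $ (- i))}"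

definition Sp :: "('r::comm_ring_1, 'n::finite) sqmat monoid" where
  "Sp = \<lparr>carrier = Sp_carrier, mult = (**), one = mat 1\<rparr>"

text \<open>\<open>axis i (axis j \<xi>)\<close> is the matrix with entry \<open>\<xi>\<close> at \<open>(i, j)\<close> and zeros elsewhere.\<close>

definition T_long :: "'n idx \<Rightarrow> 'r \<Rightarrow> ('r::comm_ring_1, 'n::finite) sqmat" where
  "T_long i \<xi> = mat 1 + axis i (axis (- i) \<xi>)"

definition T_short :: "'n idx \<Rightarrow> 'n idx \<Rightarrow> 'r \<Rightarrow> ('r::comm_ring_1, 'n::finite) sqmat" where
  "T_short i j \<xi> = mat 1 + axis i (axis j \<xi>) - axis (- j) (axis (- i) (eps i * eps j * \<xi>))"

definition transporter :: "('a, 'b) monoid_scheme \<Rightarrow> 'a set \<Rightarrow> 'a set \<Rightarrow> 'a set" where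
  "transporter G A B = {a \<in> carrier G. \<forall>t\<in>A. a \<otimes>\<^bsub>G\<^esub> t \<otimes>\<^bsub>G\<^esub> inv\<^bsub>G\<^esub> a \<in> B}"

section \<open>Ideals and form nets of ideals\<close>

text \<open>
  A commutative ring as a module over itself: the submodules are the ideals,
  and the span of a set is the ideal generated by it.
\<close>

interpretation self_module: Modules.module "(*) :: 'r::comm_ring_1 \<Rightarrow> 'r \<Rightarrow> 'r"
  by unfold_locales (simp_all add: algebra_simps)

abbreviation is_ideal :: "'r::comm_ring_1 set \<Rightarrow> bool" where
  "is_ideal \<equiv> self_module.subspace"

abbreviation ideal_gen :: "'r::comm_ring_1 set \<Rightarrow> 'r set" where
  "ideal_gen \<equiv> self_module.span"

definition ideal_mult :: "'r::comm_ring_1 set \<Rightarrow> 'r set \<Rightarrow> 'r set" where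
  "ideal_mult A B = ideal_gen {x * y | x y. x \<in> A \<and> y \<in> B}"

definition add_subgroup :: "'r::comm_ring_1 set \<Rightarrow> bool" where
  "add_subgroup A \<longleftrightarrow> 0 \<in> A \<and> (\<forall>x\<in>A. \<forall>y\<in>A. x + y \<in> A) \<and> (\<forall>x\<in>A. - x \<in> A)"

definition net :: "('n idx \<Rightarrow> 'n idx \<Rightarrow> 'r::comm_ring_1 set) \<Rightarrow> bool" where
  "net \<sigma> \<longleftrightarrow> (\<forall>i j. is_ideal (\<sigma> i j)) \<and> (\<forall>i j k. ideal_mult (\<sigma> i k) (\<sigma> k j) \<subseteq> \<sigma> i j)"

definition unitary_net :: "('n idx \<Rightarrow> 'n idx \<Rightarrow> 'r::comm_ring_1 set) \<Rightarrow> bool" where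
  "unitary_net \<sigma> \<longleftrightarrow> net \<sigma> \<and> (\<forall>i j. \<sigma> i j = \<sigma> (- j) (- i))"

definition D_net :: "('n idx \<Rightarrow> 'n idx \<Rightarrow> 'r::comm_ring_1 set) \<Rightarrow> bool" where
  "D_net \<sigma> \<longleftrightarrow> net \<sigma> \<and> (\<forall>i. \<sigma> i i = UNIV)"

type_synonym ('r, 'n) net_pair =
  "('n idx \<Rightarrow> 'n idx \<Rightarrow> 'r set) \<times> ('n idx \<Rightarrow> 'r set)"

definition form_net :: "('r::comm_ring_1, 'n) net_pair \<Rightarrow> bool" where
  "form_net = (\<lambda>(\<sigma>, \<Gamma>). net \<sigma> \<and>
     (\<forall>i. add_subgroup (\<Gamma> i)) \<and>
     (\<forall>i. (\<forall>x\<in>\<sigma> i (- i). 2 * x \<in> \<Gamma> i) \<and> \<Gamma> i \<subseteq> \<sigma> i (- i)) \<and>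
     (\<forall>i j. \<forall>\<xi>\<in>\<sigma> i j. \<forall>\<alpha>\<in>\<Gamma> j. \<xi>\<^sup>2 * \<alpha> \<in> \<Gamma> i))"

text \<open>The sums below are elementwise sums of subsets of the ring, hence sums of ideals.\<close>

definition exact_form_net :: "('r::comm_ring_1, 'n::finite) net_pair \<Rightarrow> bool" where
  "exact_form_net = (\<lambda>(\<sigma>, \<Gamma>). form_net (\<sigma>, \<Gamma>) \<and>
     (\<forall>i. \<sigma> i (- i) =
        (\<Sum>k\<in>UNIV - {i, - i}. ideal_mult (\<sigma> i k) (\<sigma> k (- i))) + ideal_gen (\<Gamma> i)))"

definition unitary_exact_form_D_net :: "('r::comm_ring_1, 'n::finite) net_pair \<Rightarrow> bool" where
  "unitary_exact_form_D_net = (\<lambda>(\<sigma>, \<Gamma>).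
     exact_form_net (\<sigma>, \<Gamma>) \<and> unitary_net \<sigma> \<and> D_net \<sigma>)"

definition form_net_le :: "('r, 'n) net_pair \<Rightarrow> ('r, 'n) net_pair \<Rightarrow> bool" where
  "form_net_le = (\<lambda>(\<sigma>', \<Gamma>') (\<sigma>'', \<Gamma>'').
     (\<forall>i j. \<sigma>' i j \<subseteq> \<sigma>'' i j) \<and> (\<forall>i. \<Gamma>' i \<subseteq> \<Gamma>'' i))"

definition rel_form_net :: "('n idx \<times> 'n idx) set \<Rightarrow> ('r::comm_ring_1, 'n) net_pair" where
  "rel_form_net \<nu> =
     ((\<lambda>i j. if (i, j) \<in> \<nu> then UNIV else {0}), (\<lambda>i. if (i, - i) \<in> \<nu> then UNIV else {0}))"

section \<open>The subgroups of a form net\<close>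

definition Ep_net :: "('r::comm_ring_1, 'n::finite) net_pair \<Rightarrow> ('r, 'n) sqmat set" where
  "Ep_net = (\<lambda>(\<sigma>, \<Gamma>). generate Sp
     ({T_short i j \<xi> | i j \<xi>. i \<noteq> j \<and> i \<noteq> - j \<and> \<xi> \<in> \<sigma> i j} \<union>
      {T_long i \<alpha> | i \<alpha>. \<alpha> \<in> \<Gamma> i}))"

text \<open>\<open>S_len i g\<close> is the element \<open>S\<^sub>i\<^sub>,\<^sub>-\<^sub>i(g)\<close>; the sum extends over the positive indices.\<close>

definition S_len :: "'n idx \<Rightarrow> ('r::comm_ring_1, 'n::finite) sqmat \<Rightarrow> 'r" where
  "S_len i g = (\<Sum>j\<in>UNIV. g $ i $ Pos j * matrix_inv g $ Pos j $ (- i))"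

definition Sp_net :: "('r::comm_ring_1, 'n::finite) net_pair \<Rightarrow> ('r, 'n) sqmat set" where
  "Sp_net = (\<lambda>(\<sigma>, \<Gamma>). {g \<in> carrier Sp.
     (\<forall>i j. g $ i $ j \<in> \<sigma> i j) \<and> (\<forall>i. S_len i g \<in> \<Gamma> i)})"

end

theory Submission
  imports Defs
begin

text \<open>
  Write \<open>b\<close> for the inverse of \<open>a\<close>. On the symplectic group \<open>S_len i g\<close> is, up to sign, the value
  \<open>row_form g i\<close> of the quadratic form \<open>\<Sum>\<^sub>m v\<^sub>m v\<^sub>-\<^sub>m\<close> on the \<open>i\<close>-th row of \<open>g\<close>; signs are irrelevant
  for membership in \<open>\<Gamma>\<^sub>i\<close>, so the whole argument uses \<open>row_form\<close>. The polarization of this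
  form differs from twice a bilinear form by the symplectic form only, and the rows of a symplectic
  matrix are a symplectic basis. Hence \<open>row_form_mult\<close>:
  \<open>row_form (g h) i = row_form g i + \<Sum>\<^sub>k g\<^sub>i\<^sub>k\<^sup>2 row_form h k\<close> up to doubled products of entries. Since
  \<open>2 \<sigma>\<^sub>i\<^sub>,\<^sub>-\<^sub>i \<le> \<Gamma>\<^sub>i\<close>, such doubles are negligible. Everything about the groups \<open>\<Gamma>\<close> is therefore
  a computation modulo doubles, where squaring is additive.

  If (T1) holds, the law yields \<open>row_form_conj\<close>: modulo \<open>\<Gamma>\<^sub>i\<close>, the value of \<open>row_form\<close> on the \<open>i\<close>-th
  row of \<open>a \<tau> b\<close> is the sum of \<open>a\<^sub>i\<^sub>k\<^sup>2 row_form \<tau> k\<close> over \<open>k\<close> and of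
  \<open>a\<^sub>i\<^sub>k\<^sup>2 (\<tau> - e)\<^sub>k\<^sub>l\<^sup>2 row_form b l\<close> over \<open>k\<close> and \<open>l\<close>. These are the quantities that (T3) and (T2)
  control.

  \<^item> (T1)--(T3) imply that conjugation by \<open>a\<close> maps \<open>Sp_net (\<sigma>, \<Gamma>)\<close> into itself, at once by
    \<open>row_form_conj\<close>. To see that \<open>a\<close> normalizes the group, (T1)--(T3) must pass to the inverse.
    Here the finiteness of the index set enters, through a form of Cramer's rule
    (\<open>det_mult_preimage\<close>): if multiplication by the entries of a matrix maps the members of a
    family of subgroups into each other, and also each member into itself, then the adjugate
    matrix respects the family, too. For (T1) it is applied to
    the tensor square \<open>a\<^sub>i\<^sub>j b\<^sub>k\<^sub>l\<close> acting on the ideals \<open>\<sigma>\<^sub>j\<^sub>k\<close>, for (T3) to the matrix of squares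
    \<open>a\<^sub>i\<^sub>j\<^sup>2\<close> acting on the groups \<open>\<Gamma>\<^sub>j\<close>. The determinant of the latter is a unit square modulo 2.

  \<^item> The normalizer lies in the transporter because \<open>Ep_net (\<sigma>, \<Gamma>) \<subseteq> Sp_net (\<sigma>, \<Gamma>)\<close>.

  \<^item> Let \<open>a\<close> be in the transporter. The matrices \<open>X\<close> such that the entries of \<open>a X b\<close> lie in \<open>\<sigma>\<close> form
    a ring containing \<open>\<tau> - e\<close> for every elementary \<open>\<tau>\<close>. As the classes have at
    least three elements, products of such differences give all diagonal matrix units and then all
    \<open>\<xi> e\<^sub>j\<^sub>k\<close> with \<open>\<xi> \<in> \<sigma>\<^sub>j\<^sub>k\<close>, which is (T1). Now \<open>row_form_conj\<close> applies: it says that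
    the \<open>defect\<close> of \<open>\<tau> - e\<close>, an additive function modulo \<open>\<Gamma>\<^sub>i\<close>, vanishes for products \<open>\<tau>\<close> of short
    transvections. Products of two of them give off-diagonal cases of (T2) and, by comparison
    with the long transvections, (T3). If \<open>j\<close> and \<open>-j\<close> are not equivalent, all off-diagonal cases arise in
    this way, and a product of three gives the diagonal case. If they are equivalent, then \<open>\<Gamma>\<^sub>j\<close> is the whole ring and (T2) follows from (T3).
\<close>

(* For the ring as a module over itself this rule is the law of associativity read from right to
   left; as a rewrite rule it does not terminate together with mult.assoc. *)
declare self_module.scale_scale [simp del]

section \<open>Sums and squares modulo doubled elements\<close>

lemma add_subgroup_zero: "add_subgroup A \<Longrightarrow> 0 \<in> A"
  and add_subgroup_add: "add_subgroup A \<Longrightarrow> x \<in> A \<Longrightarrow> y \<in> A \<Longrightarrow> x + y \<in> A"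
  and add_subgroup_uminus: "add_subgroup A \<Longrightarrow> x \<in> A \<Longrightarrow> - x \<in> A"
  by (auto simp: add_subgroup_def)

lemma add_subgroup_diff: "add_subgroup A \<Longrightarrow> x \<in> A \<Longrightarrow> y \<in> A \<Longrightarrow> x - y \<in> A"
  using add_subgroup_add[of A x "- y"] add_subgroup_uminus[of A y] by simp

lemma add_subgroup_sum:
  assumes "add_subgroup A" "\<And>k. k \<in> K \<Longrightarrow> f k \<in> A"
  shows "sum f K \<in> A"
  using assms(2)
  by (induction K rule: infinite_finite_induct)
    (auto intro: add_subgroup_zero[OF assms(1)] add_subgroup_add[OF assms(1)])

lemma add_subgroup_ideal: "is_ideal A \<Longrightarrow> add_subgroup A"
  by (auto simp: add_subgroup_def self_module.subspace_0 self_module.subspace_add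
      self_module.subspace_neg)

text \<open>
  The off-diagonal terms of a symmetric double sum come in equal pairs. This is the main source of
  the doubles that are neglected later; the subgroup \<open>A\<close> records where they lie.
\<close>
lemma symmetric_double_sum:
  fixes F :: "'i \<Rightarrow> 'i \<Rightarrow> 'r::comm_ring_1"
  assumes "finite K" and A: "add_subgroup A" and FA: "\<And>k l. F k l \<in> A"
    and sym: "\<And>k l. k \<noteq> l \<Longrightarrow> F k l = F l k"
  shows "\<exists>e\<in>A. (\<Sum>k\<in>K. \<Sum>l\<in>K. F k l) = (\<Sum>k\<in>K. F k k) + 2 * e"
  using \<open>finite K\<close>
proof (induction K rule: finite_induct)
  case empty
  then show ?case using add_subgroup_zero[OF A] by force
next
  case (insert x K)
  then obtain e where e: "e \<in> A" "(\<Sum>k\<in>K. \<Sum>l\<in>K. F k l) = (\<Sum>k\<in>K. F k k) + 2 * e"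
    by blast
  have "(\<Sum>k\<in>K. F k x) = (\<Sum>k\<in>K. F x k)"
    using insert.hyps by (intro sum.cong refl sym) auto
  then have "(\<Sum>k\<in>insert x K. \<Sum>l\<in>insert x K. F k l)
      = (\<Sum>k\<in>insert x K. F k k) + 2 * (e + (\<Sum>k\<in>K. F x k))"
    using insert.hyps e(2) by (simp add: sum.distrib algebra_simps)
  then show ?case
    using add_subgroup_add[OF A e(1) add_subgroup_sum[OF A, of K "F x"]] FA by blast
qed

lemma square_of_sum:
  fixes x :: "'i \<Rightarrow> 'r::comm_ring_1"
  assumes "finite K" "add_subgroup A" "\<And>k l. x k * x l \<in> A"
  shows "\<exists>e\<in>A. (\<Sum>k\<in>K. x k)\<^sup>2 = (\<Sum>k\<in>K. (x k)\<^sup>2) + 2 * e"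
  using symmetric_double_sum[of K A "\<lambda>k l. x k * x l"] assms
  by (simp add: sum_product power2_eq_square mult.commute)

section \<open>Cramer's rule for families of subgroups\<close>

text \<open>
  Multiplication by \<open>F i j\<close> carries \<open>P i\<close> to \<open>P j\<close> and preserves every \<open>P m\<close>. The product over \<open>A\<close> of the
  entries \<open>F i (p i)\<close> contains those along the path from \<open>m\<close> to \<open>p m\<close>, \<open>p (p m)\<close>, \<dots>, which by injectivity
  of \<open>p\<close> on \<open>A\<close> can only end at \<open>k\<close>: they move an element of \<open>P m\<close> to \<open>P k\<close> step by step. The remaining
  entries, on the cycles of \<open>p\<close>, are harmless by the second assumption.
\<close>
lemma prod_along_walk:
  fixes F :: "'k \<Rightarrow> 'k \<Rightarrow> 'r::comm_ring_1"
  assumes move: "\<And>i j x. x \<in> P i \<Longrightarrow> x * F i j \<in> P j"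
    and stay: "\<And>i j m x. x \<in> P m \<Longrightarrow> x * F i j \<in> P m"
  shows "\<lbrakk>finite A; k \<notin> A; m \<in> insert k A; inj_on p A; p ` A \<subseteq> insert k A - {m}; x \<in> P m\<rbrakk>
    \<Longrightarrow> x * (\<Prod>i\<in>A. F i (p i)) \<in> P k"
proof (induction "card A" arbitrary: A m x)
  case 0
  from \<open>0 = card A\<close> \<open>finite A\<close> have "A = {}" by simp
  moreover from this \<open>m \<in> insert k A\<close> have "m = k" by simp
  ultimately show ?case using \<open>x \<in> P m\<close> by simp
next
  case (Suc c)
  show ?case
  proof (cases "m = k")
    case True
    have "x * (\<Prod>i\<in>B. F i (p i)) \<in> P k" if "finite B" for B
      using that
    proof (induction B rule: finite_induct)
      case empty
      then show ?case using Suc.prems(6) unfolding True by simp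
    next
      case (insert b B)
      have "x * (\<Prod>i\<in>B. F i (p i)) * F b (p b) \<in> P k"
        by (rule stay[OF insert.IH])
      also have "x * (\<Prod>i\<in>B. F i (p i)) * F b (p b) = x * (\<Prod>i\<in>insert b B. F i (p i))"
        unfolding prod.insert[OF insert.hyps] by (simp only: mult.assoc mult.commute[of "F b (p b)"])
      finally show ?case .
    qed
    then show ?thesis using Suc.prems(1) by simp
  next
    case False
    then have mA: "m \<in> A" using Suc.prems by simp
    have pm: "p m \<in> insert k (A - {m})" using Suc.prems(5) mA by blast
    have "p i \<noteq> p m" if "i \<in> A - {m}" for i
      using inj_on_contraD[OF Suc.prems(4), of i m] mA that by blast
    then have "p ` (A - {m}) \<subseteq> insert k (A - {m}) - {p m}"
      using Suc.prems(5) by fast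
    moreover have "card (A - {m}) = c" using Suc.hyps(2) mA Suc.prems(1) by simp
    moreover have "inj_on p (A - {m})" using Suc.prems(4) by (rule inj_on_subset) auto
    ultimately have "x * F m (p m) * (\<Prod>i\<in>A - {m}. F i (p i)) \<in> P k"
      by (intro Suc.hyps(1)[OF _ _ _ pm] move Suc.prems(6)) (simp_all add: Suc.prems(1,2))
    then show ?thesis unfolding prod.remove[OF Suc.prems(1) mA] by (simp only: mult.assoc)
  qed
qed

text \<open>
  Cramer's rule in row form, over an arbitrary commutative ring.
\<close>
lemma det_replaced_row:
  fixes \<Psi> :: "'r::comm_ring_1 ^ 'k ^ 'k"
  shows "det (\<chi> i. if i = k then y v* \<Psi> else \<Psi> $ i) = y $ k * det \<Psi>"
proof -
  have row: "y v* \<Psi> = (\<Sum>l\<in>UNIV. y $ l *s \<Psi> $ l)"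
    by (simp add: vec_eq_iff vector_matrix_mult_def mult.commute)
  have "det (\<chi> i. if i = k then y v* \<Psi> else \<Psi> $ i)
      = (\<Sum>l\<in>UNIV. y $ l * det (\<chi> i. if i = k then \<Psi> $ l else \<Psi> $ i))"
    unfolding row det_linear_row_sum[OF finite] det_row_mul ..
  also have "\<dots> = (\<Sum>l\<in>UNIV. if l = k then y $ k * det \<Psi> else 0)"
  proof (rule sum.cong[OF refl])
    fix l
    show "y $ l * det (\<chi> i. if i = k then \<Psi> $ l else \<Psi> $ i) = (if l = k then y $ k * det \<Psi> else 0)"
    proof (cases "l = k")
      case True
      then have "(\<chi> i. if i = k then \<Psi> $ l else \<Psi> $ i) = \<Psi>" by (simp add: vec_eq_iff)
      then show ?thesis using True by simp
    next
      case False
      then have "det (\<chi> i. if i = k then \<Psi> $ l else \<Psi> $ i) = 0"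
        by (intro det_identical_rows[of l k]) (auto simp: row_def)
      then show ?thesis using False by simp
    qed
  qed
  finally show ?thesis by simp
qed

text \<open>
  If a matrix respects a family of subgroups, then so does its inverse up to the determinant. In
  the expansion of the determinant whose \<open>k\<close>-th row is \<open>y v* \<Psi>\<close>, the term of a permutation \<open>p\<close> starts
  with an element of \<open>P (p k)\<close>, and the other factors of the term lead from \<open>p k\<close> back to \<open>k\<close>.
\<close>
lemma det_mult_preimage:
  fixes \<Psi> :: "'r::comm_ring_1 ^ 'k ^ 'k"
  assumes P: "\<And>k. add_subgroup (P k)"
    and move: "\<And>i j x. x \<in> P i \<Longrightarrow> x * \<Psi> $ i $ j \<in> P j"
    and stay: "\<And>i j m x. x \<in> P m \<Longrightarrow> x * \<Psi> $ i $ j \<in> P m"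
    and y: "\<And>j. (y v* \<Psi>) $ j \<in> P j"
  shows "y $ k * det \<Psi> \<in> P k"
proof -
  let ?b = "y v* \<Psi>"
  have term_in: "of_int (sign p) * (\<Prod>i\<in>UNIV. (if i = k then ?b else \<Psi> $ i) $ p i) \<in> P k"
    if p: "p permutes UNIV" for p
  proof -
    have inj: "inj p" using p by (rule permutes_inj)
    then have "p ` (UNIV - {k}) \<subseteq> insert k (UNIV - {k}) - {p k}"
      by (auto dest: injD)
    then have "?b $ p k * (\<Prod>i\<in>UNIV - {k}. \<Psi> $ i $ p i) \<in> P k"
      using inj by (intro prod_along_walk[of P "\<lambda>i j. \<Psi> $ i $ j" "UNIV - {k}" k "p k"])
        (auto intro: move stay y inj_on_subset)
    moreover have "(\<Prod>i\<in>UNIV. (if i = k then ?b else \<Psi> $ i) $ p i)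
        = ?b $ p k * (\<Prod>i\<in>UNIV - {k}. \<Psi> $ i $ p i)"
      by (simp add: prod.remove[of UNIV k])
    ultimately show ?thesis
      using add_subgroup_uminus[OF P] by (cases p rule: sign_cases) auto
  qed
  have "det (\<chi> i. if i = k then ?b else \<Psi> $ i) \<in> P k"
    unfolding det_def by (intro add_subgroup_sum[OF P]) (use term_in in simp)
  then show ?thesis by (simp add: det_replaced_row)
qed

text \<open>
  Modulo 2 squaring is a ring endomorphism and signs disappear.
\<close>
lemma det_of_squares:
  fixes A :: "'r::comm_ring_1 ^ 'k ^ 'k"
  shows "\<exists>r. det (\<chi> i j. (A $ i $ j)\<^sup>2) = (det A)\<^sup>2 + 2 * r"
proof -
  let ?S = "{p. p permutes (UNIV :: 'k set)}"
  define t where "t p = (\<Prod>i\<in>UNIV. A $ i $ p i)" for p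
  define c where "c p = (if (of_int (sign p) :: 'r) = 1 then 0 else - (t p)\<^sup>2)" for p
  have sgn: "of_int (sign p) * (t p)\<^sup>2 = (t p)\<^sup>2 + 2 * c p"
    "(of_int (sign p) * t p)\<^sup>2 = (t p)\<^sup>2" for p
    by (cases p rule: sign_cases; auto simp: c_def)+
  obtain e where "(\<Sum>p\<in>?S. of_int (sign p) * t p)\<^sup>2
      = (\<Sum>p\<in>?S. (of_int (sign p) * t p)\<^sup>2) + 2 * e"
    using square_of_sum[of ?S UNIV "\<lambda>p. of_int (sign p) * t p"]
    by (auto simp: add_subgroup_def finite_permutations)
  then have 1: "(det A)\<^sup>2 = (\<Sum>p\<in>?S. (t p)\<^sup>2) + 2 * e"
    by (simp add: det_def t_def[symmetric] sgn)
  have "det (\<chi> i j. (A $ i $ j)\<^sup>2) = (\<Sum>p\<in>?S. of_int (sign p) * (t p)\<^sup>2)"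
    by (simp add: det_def t_def prod_power_distrib)
  also have "\<dots> = (\<Sum>p\<in>?S. (t p)\<^sup>2) + 2 * (\<Sum>p\<in>?S. c p)"
    by (simp only: sgn sum.distrib sum_distrib_left)
  also have "\<dots> = (det A)\<^sup>2 + 2 * ((\<Sum>p\<in>?S. c p) - e)"
    by (simp only: 1) (simp add: algebra_simps)
  finally show ?thesis by blast
qed

section \<open>The symplectic group\<close>

lemma uminus_uminus_idx [simp]: "- (- i) = (i :: 'n idx)"
  by (cases i) simp_all

lemma uminus_idx_neq [simp]: "- i \<noteq> (i :: 'n idx)" "i \<noteq> - (i :: 'n idx)"
  by (cases i; simp)+

lemma uminus_idx_eq_iff [simp]: "- i = - j \<longleftrightarrow> i = (j :: 'n idx)"
  by (metis uminus_uminus_idx)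

lemma uminus_idx_swap: "- i = j \<longleftrightarrow> i = - (j :: 'n idx)"
  by (metis uminus_uminus_idx)

lemma eps_uminus [simp]: "eps (- i) = - eps i"
  by (cases i) simp_all

lemma eps_square [simp]: "eps i * eps i = 1" "eps i * (eps i * x) = x"
  by (cases i; simp)+

lemma eps_cases: "eps i = 1 \<or> eps i = - 1"
  by (cases i) simp_all

lemma sum_idx:
  "(\<Sum>i\<in>UNIV. f i) = (\<Sum>m\<in>UNIV. f (Pos m)) + (\<Sum>m\<in>UNIV. f (Neg (m :: 'n::finite)) :: 'a::comm_monoid_add)"
proof -
  have UNIV: "(UNIV :: 'n idx set) = range Pos \<union> range Neg"
  proof -
    have "x \<in> range Pos \<union> range Neg" for x :: "'n idx"
      by (cases x) simp_all
    then show ?thesis by blast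
  qed
  have "sum f (range Pos \<union> range Neg) = sum f (range Pos) + sum f (range Neg)"
    by (rule sum.union_disjoint) auto
  also have "sum f (range Pos) = (\<Sum>m\<in>UNIV. f (Pos m))"
    by (simp add: sum.reindex inj_def)
  also have "sum f (range Neg) = (\<Sum>m\<in>UNIV. f (Neg m))"
    by (simp add: sum.reindex inj_def)
  finally show ?thesis by (simp add: UNIV)
qed

lemma sum_idx_uminus: "(\<Sum>i\<in>UNIV. f (- i)) = (\<Sum>i\<in>UNIV. f (i :: 'n::finite idx))"
  by (rule sum.reindex_bij_witness[of _ uminus uminus]) auto

lemma matrix_inv_unique:
  assumes "a ** b = mat 1" "b ** a = mat 1"
  shows "matrix_inv a = b"
proof -
  have "a ** matrix_inv a = mat 1 \<and> matrix_inv a ** a = mat 1"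
    unfolding matrix_inv_def by (rule someI[of _ b]) (simp add: assms)
  then have "matrix_inv a = (b ** a) ** matrix_inv a" "b ** (a ** matrix_inv a) = b"
    by (simp_all add: assms)
  then show ?thesis by (simp add: matrix_mul_assoc)
qed

lemma Sp_carrierI:
  assumes "a ** b = mat 1" "b ** a = mat 1"
    and "\<And>i j. b $ i $ j = eps i * eps j * a $ (- j) $ (- i)"
  shows "a \<in> Sp_carrier"
  using assms matrix_inv_unique[OF assms(1,2)] by (auto simp: Sp_carrier_def invertible_def)

lemma Sp_carrierD:
  assumes "a \<in> Sp_carrier"
  shows "a ** matrix_inv a = mat 1" "matrix_inv a ** a = mat 1"
    and "matrix_inv a $ i $ j = eps i * eps j * a $ (- j) $ (- i)"
proof -
  obtain b where b: "a ** b = mat 1" "b ** a = mat 1"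
    using assms by (auto simp: Sp_carrier_def invertible_def)
  then show "a ** matrix_inv a = mat 1" "matrix_inv a ** a = mat 1"
    by (simp_all add: matrix_inv_unique[OF b])
  show "matrix_inv a $ i $ j = eps i * eps j * a $ (- j) $ (- i)"
    using assms by (simp add: Sp_carrier_def)
qed

lemma Sp_entry:
  assumes "a \<in> Sp_carrier"
  shows "a $ i $ j = eps i * eps j * matrix_inv a $ (- j) $ (- i)"
  by (simp add: Sp_carrierD(3)[OF assms] mult_ac)

lemma matrix_inv_in_Sp:
  assumes "a \<in> Sp_carrier"
  shows "matrix_inv a \<in> Sp_carrier" and "matrix_inv (matrix_inv a) = a"
proof -
  note D = Sp_carrierD[OF assms]
  show "matrix_inv (matrix_inv a) = a"
    by (rule matrix_inv_unique) (use D in auto)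
  show "matrix_inv a \<in> Sp_carrier"
    by (rule Sp_carrierI[OF D(2,1) Sp_entry[OF assms]])
qed

lemma one_in_Sp: "mat 1 \<in> (Sp_carrier :: ('r::comm_ring_1, 'n::finite) sqmat set)"
proof (rule Sp_carrierI)
  show "(mat 1 :: ('r, 'n) sqmat) $ i $ j
      = eps i * eps j * (mat 1 :: ('r, 'n) sqmat) $ (- j) $ (- i)" for i j :: "'n idx"
    by (auto simp: mat_def)
qed simp_all

lemma mult_in_Sp:
  fixes a b :: "('r::comm_ring_1, 'n::finite) sqmat"
  assumes a: "a \<in> Sp_carrier" and b: "b \<in> Sp_carrier"
  shows "a ** b \<in> Sp_carrier" and "matrix_inv (a ** b) = matrix_inv b ** matrix_inv a"
proof -
  note Da = Sp_carrierD[OF a] and Db = Sp_carrierD[OF b]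
  have "(a ** b) ** (matrix_inv b ** matrix_inv a) = a ** (b ** matrix_inv b) ** matrix_inv a"
    by (simp only: matrix_mul_assoc)
  then have 1: "(a ** b) ** (matrix_inv b ** matrix_inv a) = mat 1" by (simp add: Da Db)
  have "(matrix_inv b ** matrix_inv a) ** (a ** b) = matrix_inv b ** (matrix_inv a ** a) ** b"
    by (simp only: matrix_mul_assoc)
  then have 2: "(matrix_inv b ** matrix_inv a) ** (a ** b) = mat 1" by (simp add: Da Db)
  show "matrix_inv (a ** b) = matrix_inv b ** matrix_inv a"
    by (rule matrix_inv_unique[OF 1 2])
  show "a ** b \<in> Sp_carrier"
  proof (rule Sp_carrierI[OF 1 2])
    fix i j
    have "(matrix_inv b ** matrix_inv a) $ i $ j
        = (\<Sum>k\<in>UNIV. eps i * eps j * (a $ (- j) $ (- k) * b $ (- k) $ (- i)))"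
      unfolding matrix_matrix_mult_def
      by (simp add: Da(3) Db(3) mult_ac) 
    also have "\<dots> = (\<Sum>k\<in>UNIV. eps i * eps j * (a $ (- j) $ k * b $ k $ (- i)))"
      by (rule sum_idx_uminus)
    finally show "(matrix_inv b ** matrix_inv a) $ i $ j = eps i * eps j * (a ** b) $ (- j) $ (- i)"
      by (simp add: matrix_matrix_mult_def sum_distrib_left)
  qed
qed

lemma Sp_simps [simp]:
  "carrier Sp = Sp_carrier" "x \<otimes>\<^bsub>Sp\<^esub> y = x ** y" "\<one>\<^bsub>Sp\<^esub> = mat 1"
  by (simp_all add: Sp_def)

lemma group_Sp: "Group.group (Sp :: ('r::comm_ring_1, 'n::finite) sqmat monoid)"
proof (rule groupI)
  fix x :: "('r, 'n) sqmat"
  assume "x \<in> carrier Sp"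
  then show "\<exists>y\<in>carrier Sp. y \<otimes>\<^bsub>Sp\<^esub> x = \<one>\<^bsub>Sp\<^esub>"
    using matrix_inv_in_Sp(1) Sp_carrierD(2) by force
qed (auto simp: mult_in_Sp one_in_Sp matrix_mul_assoc)

lemma inv_Sp:
  assumes "a \<in> Sp_carrier"
  shows "inv\<^bsub>Sp\<^esub> a = matrix_inv a"
  using group.inv_equality[OF group_Sp, of "matrix_inv a" a] Sp_carrierD(2)[OF assms]
    matrix_inv_in_Sp(1)[OF assms] assms by simp

section \<open>The quadratic form on the rows of a symplectic matrix\<close>

text \<open>
  The rows of a symplectic matrix form a symplectic basis. Isolating one of the two halves of the
  symplectic form as a non-symmetric bilinear form shows that the latter is symmetric except on the pairs
  of opposite rows.
\<close>
lemma symplectic_rows: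
  fixes g :: "('r::comm_ring_1, 'n::finite) sqmat"
  assumes "g \<in> Sp_carrier"
  shows "(\<Sum>m\<in>UNIV. g $ k $ Pos m * g $ l $ Neg m)
    = (\<Sum>m\<in>UNIV. g $ l $ Pos m * g $ k $ Neg m) + (if l = - k then eps k else 0)"
proof -
  have "(g ** matrix_inv g) $ k $ (- l) = - eps l * (\<Sum>j\<in>UNIV. eps j * (g $ k $ j * g $ l $ (- j)))"
    by (simp add: matrix_matrix_mult_def Sp_carrierD(3)[OF assms] sum_distrib_left sum_negf mult_ac)
  then have "- eps l * (\<Sum>j\<in>UNIV. eps j * (g $ k $ j * g $ l $ (- j))) = (if k = - l then 1 else 0)"
    by (simp add: Sp_carrierD(1)[OF assms] mat_def)
  then have "- eps l * (- eps l * (\<Sum>j\<in>UNIV. eps j * (g $ k $ j * g $ l $ (- j))))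
      = - eps l * (if k = - l then 1 else 0)"
    by simp
  then have "(\<Sum>j\<in>UNIV. eps j * (g $ k $ j * g $ l $ (- j))) = (if k = - l then - eps l else 0)"
    by (simp split: if_splits)
  then show ?thesis
    by (auto simp: sum_idx sum_negf mult_ac algebra_simps split: if_splits)
qed

text \<open>
  The hyperbolic quadratic form evaluated at the \<open>i\<close>-th row of \<open>g\<close>. For symplectic \<open>g\<close> it is
  the length \<open>S_len i g\<close> up to sign, but its multiplication law is free of signs.
\<close>
definition row_form :: "('r::comm_ring_1, 'n::finite) sqmat \<Rightarrow> 'n idx \<Rightarrow> 'r" where
  "row_form g i = (\<Sum>m\<in>UNIV. g $ i $ Pos m * g $ i $ Neg m)"

lemma S_len_eq_row_form:
  assumes "g \<in> Sp_carrier"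
  shows "S_len i g = - eps i * row_form g i"
  by (simp add: S_len_def row_form_def Sp_carrierD(3)[OF assms] sum_distrib_left sum_negf mult_ac)

lemma row_form_one [simp]: "row_form (mat 1) i = 0"
  by (cases i) (auto simp: row_form_def mat_def intro: sum.neutral)

text \<open>
  The \<open>i\<close>-th row of \<open>g ** h\<close> is a combination of the rows of \<open>h\<close>. The rows \<open>Pos m\<close> and \<open>Neg m\<close> are grouped into a
  vector \<open>w m\<close>; different groups are orthogonal for the symplectic form, so that the bilinear form is
  symmetric on them and contributes doubles only. Within one group the non-symmetry of the pair
  contributes \<open>g\<^sub>i\<^sub>m g\<^sub>i\<^sub>,\<^sub>-\<^sub>m\<close>, and these terms add up to \<open>row_form g i\<close>.
\<close>
lemma row_form_mult:
  fixes g h :: "('r::comm_ring_1, 'n::finite) sqmat"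
  assumes h: "h \<in> Sp_carrier" and A: "add_subgroup A"
    and gh: "\<And>k l p. (g $ i $ k * h $ k $ p) * (g $ i $ l * h $ l $ (- p)) \<in> A"
  shows "\<exists>e\<in>A. row_form (g ** h) i
    = row_form g i + (\<Sum>k\<in>UNIV. (g $ i $ k)\<^sup>2 * row_form h k) + 2 * e"
proof -
  (* w m p is the p-th entry of the m-th group, b the bilinear form whose diagonal is row_form,
     and F m m' its value on two groups. *)
  define w where "w m p = g $ i $ Pos m * h $ Pos m $ p + g $ i $ Neg m * h $ Neg m $ p" for m p
  define b where "b k l = (\<Sum>p\<in>UNIV. h $ k $ Pos p * h $ l $ Neg p)" for k l
  define F where "F m m' = (\<Sum>p\<in>UNIV. w m (Pos p) * w m' (Neg p))" for m m'
  let ?P = "\<lambda>k l. \<Sum>p\<in>UNIV. (g $ i $ k * h $ k $ Pos p) * (g $ i $ l * h $ l $ Neg p)"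
  have b: "b k l = b l k + (if l = - k then eps k else 0)" for k l
    unfolding b_def by (rule symplectic_rows[OF h])
  have P: "?P k l = g $ i $ k * g $ i $ l * b k l" for k l
    by (simp add: b_def sum_distrib_left mult_ac)
  have F: "F m m' = g $ i $ Pos m * g $ i $ Pos m' * b (Pos m) (Pos m')
      + g $ i $ Pos m * g $ i $ Neg m' * b (Pos m) (Neg m')
      + g $ i $ Neg m * g $ i $ Pos m' * b (Neg m) (Pos m')
      + g $ i $ Neg m * g $ i $ Neg m' * b (Neg m) (Neg m')" for m m'
    unfolding P[symmetric] F_def w_def sum.distrib[symmetric]
    by (rule sum.cong) (auto simp: algebra_simps)
  have diag: "row_form h k = b k k" for k
    by (simp add: b_def row_form_def)
  have PA: "g $ i $ k * g $ i $ l * b k l \<in> A" for k l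
    unfolding P[symmetric] using gh[of k "Pos _" l] by (intro add_subgroup_sum[OF A]) simp
  have "F m m' \<in> A" for m m'
    unfolding F by (intro add_subgroup_add[OF A] PA)
  moreover have "F m m' = F m' m" if "m \<noteq> m'" for m m'
    using that b[of "Pos m" "Pos m'"] b[of "Pos m" "Neg m'"] b[of "Neg m" "Pos m'"]
      b[of "Neg m" "Neg m'"] unfolding F by (simp add: algebra_simps)
  ultimately obtain e where e: "e \<in> A"
    "(\<Sum>m\<in>UNIV. \<Sum>m'\<in>UNIV. F m m') = (\<Sum>m\<in>UNIV. F m m) + 2 * e"
    using symmetric_double_sum[OF finite A, of F UNIV] by blast
  have "row_form (g ** h) i = (\<Sum>p\<in>UNIV. \<Sum>m\<in>UNIV. \<Sum>m'\<in>UNIV. w m (Pos p) * w m' (Neg p))"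
    unfolding row_form_def w_def
    by (simp add: matrix_matrix_mult_def sum_idx sum.distrib[symmetric] sum_product)
  also have "\<dots> = (\<Sum>m\<in>UNIV. \<Sum>m'\<in>UNIV. F m m')"
    unfolding F_def by (subst sum.swap, rule sum.cong[OF refl], rule sum.swap)
  also have "\<dots> = (\<Sum>m\<in>UNIV. F m m) + 2 * e" by (rule e(2))
  also have "F m m = g $ i $ Pos m * g $ i $ Neg m + (g $ i $ Pos m)\<^sup>2 * row_form h (Pos m)
      + (g $ i $ Neg m)\<^sup>2 * row_form h (Neg m)
      + 2 * (g $ i $ Neg m * g $ i $ Pos m * b (Neg m) (Pos m))" for m
    using b[of "Pos m" "Neg m"] unfolding F diag by (simp add: power2_eq_square algebra_simps)
  then have "(\<Sum>m\<in>UNIV. F m m) = row_form g i + (\<Sum>k\<in>UNIV. (g $ i $ k)\<^sup>2 * row_form h k)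
      + 2 * (\<Sum>m\<in>UNIV. g $ i $ Neg m * g $ i $ Pos m * b (Neg m) (Pos m))"
    by (simp add: row_form_def[of g] sum_idx sum.distrib sum_distrib_left add_ac)
  finally have "row_form (g ** h) i = row_form g i + (\<Sum>k\<in>UNIV. (g $ i $ k)\<^sup>2 * row_form h k)
      + 2 * ((\<Sum>m\<in>UNIV. g $ i $ Neg m * g $ i $ Pos m * b (Neg m) (Pos m)) + e)"
    by (simp add: algebra_simps)
  moreover have "(\<Sum>m\<in>UNIV. g $ i $ Neg m * g $ i $ Pos m * b (Neg m) (Pos m)) + e \<in> A"
    by (intro add_subgroup_add[OF A] e(1) add_subgroup_sum[OF A] PA)
  ultimately show ?thesis by blast
qed

section \<open>Matrix units and transvections\<close>

lemma matrix_bilinear: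
  fixes A B C :: "'r::comm_ring_1 ^ 'k::finite ^ 'k"
  shows "(A + B) ** C = A ** C + B ** C" "A ** (B + C) = A ** B + A ** C"
    "(A - B) ** C = A ** C - B ** C" "A ** (B - C) = A ** B - A ** C"
    "(- A) ** B = - (A ** B)" "A ** (- B) = - (A ** B)"
    "0 ** A = 0" "A ** 0 = 0"
  by (simp_all add: vec_eq_iff matrix_matrix_mult_def algebra_simps sum.distrib sum_subtractf
      sum_negf)

abbreviation munit :: "'n idx \<Rightarrow> 'n idx \<Rightarrow> 'r \<Rightarrow> ('r::comm_ring_1, 'n::finite) sqmat" where
  "munit i j x \<equiv> axis i (axis j x)"

lemma munit_nth: "munit i j x $ k $ l = (if k = i \<and> l = j then x else 0)"
  by (simp add: axis_def)

lemma munit_mult: "munit i j x ** munit k l y = (if j = k then munit i l (x * y) else 0)"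
proof -
  have *: "(\<Sum>k'\<in>UNIV. (if p = i \<and> k' = j then x else 0) * (if k' = k \<and> q = l then y else 0))
      = (if j = k then if p = i \<and> q = l then x * y else 0 else 0)" for p q
  proof -
    have "(\<Sum>k'\<in>UNIV. (if p = i \<and> k' = j then x else 0) * (if k' = k \<and> q = l then y else 0))
        = (\<Sum>k'\<in>UNIV. if k' = j then if j = k \<and> p = i \<and> q = l then x * y else 0 else 0)"
      by (rule sum.cong) auto
    then show ?thesis by simp
  qed
  show ?thesis
    by (simp add: vec_eq_iff matrix_matrix_mult_def munit_nth *)
qed

lemma conj_munit_nth:
  fixes a b :: "('r::comm_ring_1, 'n::finite) sqmat"
  shows "(a ** munit j k x ** b) $ i $ l = a $ i $ j * x * b $ k $ l"
proof -
  have 1: "(a ** munit j k x) $ i $ q = (if q = k then a $ i $ j * x else 0)" for q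
  proof -
    have "(a ** munit j k x) $ i $ q = (\<Sum>p\<in>UNIV. a $ i $ p * munit j k x $ p $ q)"
      by (simp add: matrix_matrix_mult_def)
    also have "\<dots> = (\<Sum>p\<in>UNIV. if p = j then if q = k then a $ i $ j * x else 0 else 0)"
      by (rule sum.cong) (auto simp: munit_nth)
    finally have "(a ** munit j k x) $ i $ q = \<dots>" .
    then show ?thesis by simp
  qed
  have "(a ** munit j k x ** b) $ i $ l = (\<Sum>q\<in>UNIV. (if q = k then a $ i $ j * x else 0) * b $ q $ l)"
    unfolding matrix_matrix_mult_def[of "a ** munit j k x"] by (simp add: 1)
  also have "\<dots> = (\<Sum>q\<in>UNIV. if q = k then a $ i $ j * x * b $ k $ l else 0)"
    by (rule sum.cong) auto
  finally show ?thesis by simp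
qed

text \<open>
  The nilpotent part of a short transvection: \<open>T_short i j \<xi>\<close> minus the identity.
\<close>
definition short_root :: "'n idx \<Rightarrow> 'n idx \<Rightarrow> 'r \<Rightarrow> ('r::comm_ring_1, 'n::finite) sqmat" where
  "short_root i j \<xi> = munit i j \<xi> - munit (- j) (- i) (eps i * eps j * \<xi>)"

lemma T_short_eq: "T_short i j \<xi> = mat 1 + short_root i j \<xi>"
  by (simp add: T_short_def short_root_def)

lemma short_root_nth:
  "short_root i j \<xi> $ k $ l = (if k = i \<and> l = j then \<xi> else 0)
    - (if k = - j \<and> l = - i then eps i * eps j * \<xi> else 0)"
  by (simp add: short_root_def munit_nth)

text \<open>
  For \<open>X\<close> of square zero the inverse of \<open>mat 1 + X\<close> is \<open>mat 1 - X\<close>, so the condition defining the symplectic group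
  becomes a linear one: \<open>X\<close> lies in the symplectic Lie algebra.
\<close>
lemma one_plus_in_Sp:
  fixes X :: "('r::comm_ring_1, 'n::finite) sqmat"
  assumes "X ** X = 0" "\<And>k l. X $ k $ l = - (eps k * eps l * X $ (- l) $ (- k))"
  shows "mat 1 + X \<in> Sp_carrier" 
proof (rule Sp_carrierI)
  show "(mat 1 - X) $ k $ l = eps k * eps l * (mat 1 + X) $ (- l) $ (- k)" for k l
    using assms(2)[of k l] by (auto simp: mat_def algebra_simps)
qed (simp_all add: matrix_bilinear assms(1))

lemma T_short_in_Sp:
  assumes "i \<noteq> j" "i \<noteq> - j"
  shows "(T_short i j \<xi> :: ('r::comm_ring_1, 'n::finite) sqmat) \<in> Sp_carrier"
  unfolding T_short_eq
proof (rule one_plus_in_Sp)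
  show "short_root i j \<xi> ** short_root i j \<xi> = (0 :: ('r, 'n) sqmat)"
    using assms(1) assms(1)[symmetric] by (simp add: short_root_def matrix_bilinear munit_mult)
  show "(short_root i j \<xi> :: ('r, 'n) sqmat) $ k $ l
      = - (eps k * eps l * short_root i j \<xi> $ (- l) $ (- k))" for k l
  proof -
    have iff: "- l = i \<and> - k = j \<longleftrightarrow> k = - j \<and> l = - i"
      using uminus_idx_swap[of l i] uminus_idx_swap[of k j] by blast
    have iff': "- l = - j \<and> - k = - i \<longleftrightarrow> k = i \<and> l = j"
      by auto
    (* Transposition exchanges the two summands of the short root matrix up to signs. *)
    have "eps i * eps j * (eps i * eps j * \<xi>) = (\<xi> :: 'r)"
      by (cases i; cases j) simp_all
    then have "(if k = i \<and> l = j then \<xi> else 0)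
          = eps k * eps l * (if k = i \<and> l = j then eps i * eps j * \<xi> else (0 :: 'r))"
      "(if k = - j \<and> l = - i then eps i * eps j * \<xi> else 0)
          = eps k * eps l * (if k = - j \<and> l = - i then \<xi> else (0 :: 'r))"
      by (simp_all add: mult.commute)
    then show ?thesis
      unfolding short_root_nth iff iff' by (simp only: right_diff_distrib minus_diff_eq)
  qed
qed

lemma T_long_in_Sp: "(T_long i \<alpha> :: ('r::comm_ring_1, 'n::finite) sqmat) \<in> Sp_carrier"
  unfolding T_long_def
proof (rule one_plus_in_Sp)
  show "(munit i (- i) \<alpha> :: ('r, 'n) sqmat) $ k $ l
      = - (eps k * eps l * munit i (- i) \<alpha> $ (- l) $ (- k))" for k l
  proof -
    have iff: "- l = i \<and> - k = - i \<longleftrightarrow> k = i \<and> l = - i"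
      using uminus_idx_swap[of l i] by auto
    show ?thesis
      unfolding munit_nth iff by simp
  qed
qed (simp add: munit_mult)

text \<open>
  No row of a short transvection has nonzero entries in two opposite columns.
\<close>
lemma row_form_T_short:
  assumes "i \<noteq> j" "i \<noteq> - j"
  shows "row_form (T_short i j \<xi>) k = 0"
proof -
  have "T_short i j \<xi> $ k $ p * T_short i j \<xi> $ k $ (- p) = 0" for p
    using assms by (auto simp: T_short_eq short_root_nth mat_def)
  from this[of "Pos _"] show ?thesis by (simp add: row_form_def)
qed

lemma row_form_T_long: "row_form (T_long i \<alpha>) k = (if k = i then \<alpha> else 0)"
proof (cases i)
  case (Pos m0)
  have "T_long i \<alpha> $ k $ Pos m * T_long i \<alpha> $ k $ Neg m = (if m = m0 then if k = i then \<alpha> else 0 else 0)" for m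
    using Pos by (auto simp: T_long_def munit_nth mat_def)
  then show ?thesis by (simp add: row_form_def)
next
  case (Neg m0)
  have "T_long i \<alpha> $ k $ Pos m * T_long i \<alpha> $ k $ Neg m = (if m = m0 then if k = i then \<alpha> else 0 else 0)" for m
    using Neg by (auto simp: T_long_def munit_nth mat_def)
  then show ?thesis by (simp add: row_form_def)
qed

section \<open>Form nets and their groups\<close>

locale unitary_form_D_net =
  fixes \<sigma> :: "'n::finite idx \<Rightarrow> 'n idx \<Rightarrow> 'r::comm_ring_1 set"
    and \<Gamma> :: "'n idx \<Rightarrow> 'r set"
  assumes form: "form_net (\<sigma>, \<Gamma>)" and unitary: "unitary_net \<sigma>" and D: "D_net \<sigma>"
begin

lemma sigma_ideal: "is_ideal (\<sigma> i j)"
  using D by (simp add: D_net_def net_def)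

lemma sigma_group: "add_subgroup (\<sigma> i j)"
  by (rule add_subgroup_ideal[OF sigma_ideal])

lemmas sigma_zero = add_subgroup_zero[OF sigma_group]
lemmas sigma_add = add_subgroup_add[OF sigma_group]
lemmas sigma_diff = add_subgroup_diff[OF sigma_group]
lemmas sigma_uminus = add_subgroup_uminus[OF sigma_group]
lemmas sigma_sum = add_subgroup_sum[OF sigma_group]

lemma sigma_scale: "x \<in> \<sigma> i j \<Longrightarrow> c * x \<in> \<sigma> i j" "x \<in> \<sigma> i j \<Longrightarrow> x * c \<in> \<sigma> i j"
  using self_module.subspace_scale[OF sigma_ideal, of x i j c] by (simp_all add: mult.commute)

lemma add_subgroup_sigma_quotient: "add_subgroup {c. c * x \<in> \<sigma> i j}"
  by (auto simp: add_subgroup_def sigma_zero distrib_right intro: sigma_add sigma_uminus)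

lemma sigma_mult: "x \<in> \<sigma> i k \<Longrightarrow> y \<in> \<sigma> k j \<Longrightarrow> x * y \<in> \<sigma> i j"
  using D self_module.span_base[of "x * y" "{x * y | x y. x \<in> \<sigma> i k \<and> y \<in> \<sigma> k j}"]
  unfolding D_net_def net_def ideal_mult_def by blast

lemma sigma_diag [simp]: "x \<in> \<sigma> i i"
  using D by (simp add: D_net_def)

lemma sigma_swap: "\<sigma> (- j) (- i) = \<sigma> i j"
  using unitary by (auto simp: unitary_net_def)

lemma sigma_swap_uminus: "\<sigma> j (- i) = \<sigma> i (- j)"
  using sigma_swap[of "- j" i] by simp

lemma sigma_mult_uminus: "x \<in> \<sigma> i p \<Longrightarrow> y \<in> \<sigma> i (- p) \<Longrightarrow> x * y \<in> \<sigma> i (- i)"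
  using sigma_mult[of x i p y "- i"] sigma_swap_uminus[of p i] by simp

lemma Gamma_group: "add_subgroup (\<Gamma> i)"
  and Gamma_double: "x \<in> \<sigma> i (- i) \<Longrightarrow> 2 * x \<in> \<Gamma> i"
  and Gamma_sigma: "x \<in> \<Gamma> i \<Longrightarrow> x \<in> \<sigma> i (- i)"
  and Gamma_square: "\<xi> \<in> \<sigma> i j \<Longrightarrow> \<alpha> \<in> \<Gamma> j \<Longrightarrow> \<xi>\<^sup>2 * \<alpha> \<in> \<Gamma> i"
  using form by (auto simp: form_net_def)

lemmas Gamma_zero = add_subgroup_zero[OF Gamma_group]
lemmas Gamma_add = add_subgroup_add[OF Gamma_group]
lemmas Gamma_diff = add_subgroup_diff[OF Gamma_group]
lemmas Gamma_uminus = add_subgroup_uminus[OF Gamma_group]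
lemmas Gamma_sum = add_subgroup_sum[OF Gamma_group]

text \<open>
  Membership in \<open>\<Gamma> i\<close> is decided modulo doubles of elements of \<open>\<sigma> i (- i)\<close>. All uses of the multiplication law
  of \<open>row_form\<close> go through this rule.
\<close>
lemma Gamma_cong: "e \<in> \<sigma> i (- i) \<Longrightarrow> x = y + 2 * e \<Longrightarrow> x \<in> \<Gamma> i \<longleftrightarrow> y \<in> \<Gamma> i"
  using Gamma_add[of y i "2 * e"] Gamma_diff[of x i "2 * e"] Gamma_double[of e i] by auto

lemma eps_sigma [simp]: "eps k * x \<in> \<sigma> i j \<longleftrightarrow> x \<in> \<sigma> i j"
proof -
  have "(eps k :: 'r) = 1 \<or> (eps k :: 'r) = - 1" by (rule eps_cases)
  then show ?thesis using sigma_uminus[of x i j] sigma_uminus[of "- x" i j] by auto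
qed

lemma eps_Gamma [simp]: "eps k * x \<in> \<Gamma> i \<longleftrightarrow> x \<in> \<Gamma> i"
proof -
  have "(eps k :: 'r) = 1 \<or> (eps k :: 'r) = - 1" by (rule eps_cases)
  then show ?thesis using Gamma_uminus[of x i] Gamma_uminus[of "- x" i] by auto
qed

text \<open>
  The following two rules remove all signs: \<open>S_len\<close> becomes \<open>row_form\<close>, and entries of an inverse become
  entries of the matrix itself.
\<close>
lemma mult_S_len_iff:
  assumes "g \<in> Sp_carrier"
  shows "c * S_len i g \<in> \<Gamma> k \<longleftrightarrow> c * row_form g i \<in> \<Gamma> k"
proof -
  have "c * S_len i g = - (eps i * (c * row_form g i))"
    by (simp add: S_len_eq_row_form[OF assms] mult_ac)
  then show ?thesis
    using Gamma_uminus[of "eps i * (c * row_form g i)" k]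
      Gamma_uminus[of "- (eps i * (c * row_form g i))" k] by auto
qed

lemma mult_inv_iff:
  assumes "g \<in> Sp_carrier"
  shows "c * matrix_inv g $ k $ l \<in> \<sigma> i j \<longleftrightarrow> c * g $ (- l) $ (- k) \<in> \<sigma> i j"
proof -
  have "c * matrix_inv g $ k $ l = eps k * (eps l * (c * g $ (- l) $ (- k)))"
    by (simp add: Sp_carrierD(3)[OF assms] mult_ac)
  then show ?thesis by simp
qed

lemma Sp_net_iff: "g \<in> Sp_net (\<sigma>, \<Gamma>) \<longleftrightarrow>
    g \<in> Sp_carrier \<and> (\<forall>i j. g $ i $ j \<in> \<sigma> i j) \<and> (\<forall>i. row_form g i \<in> \<Gamma> i)"
  using mult_S_len_iff[of g 1] by (auto simp: Sp_net_def)

lemma Sp_net_carrier: "g \<in> Sp_net (\<sigma>, \<Gamma>) \<Longrightarrow> g \<in> Sp_carrier"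
  by (simp add: Sp_net_iff)

lemma sigma_matrix_mult:
  assumes "\<And>i j. g $ i $ j \<in> \<sigma> i j" "\<And>i j. h $ i $ j \<in> \<sigma> i j"
  shows "(g ** h) $ i $ j \<in> \<sigma> i j"
proof -
  have "g $ i $ k * h $ k $ j \<in> \<sigma> i j" for k
    by (rule sigma_mult[OF assms])
  then show ?thesis by (simp add: matrix_matrix_mult_def sigma_sum)
qed

lemma row_form_mult_net:
  assumes "\<And>i j. g $ i $ j \<in> \<sigma> i j" "h \<in> Sp_carrier" "\<And>i j. h $ i $ j \<in> \<sigma> i j"
  shows "\<exists>e\<in>\<sigma> i (- i). row_form (g ** h) i
    = row_form g i + (\<Sum>k\<in>UNIV. (g $ i $ k)\<^sup>2 * row_form h k) + 2 * e"
proof (rule row_form_mult[OF assms(2) sigma_group])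
  show "(g $ i $ k * h $ k $ p) * (g $ i $ l * h $ l $ (- p)) \<in> \<sigma> i (- i)" for k l p
    by (rule sigma_mult_uminus[of _ i p]) (blast intro: sigma_mult assms)+
qed

lemma Sp_net_mult:
  assumes g: "g \<in> Sp_net (\<sigma>, \<Gamma>)" and h: "h \<in> Sp_net (\<sigma>, \<Gamma>)"
  shows "g ** h \<in> Sp_net (\<sigma>, \<Gamma>)"
proof -
  note g' = g[unfolded Sp_net_iff] and h' = h[unfolded Sp_net_iff]
  have "row_form (g ** h) i \<in> \<Gamma> i" for i
  proof -
    obtain e where "e \<in> \<sigma> i (- i)" "row_form (g ** h) i
        = row_form g i + (\<Sum>k\<in>UNIV. (g $ i $ k)\<^sup>2 * row_form h k) + 2 * e"
      using row_form_mult_net[of g h i] g' h' by blast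
    then show ?thesis
      using g' h' by (auto simp: Gamma_cong intro!: Gamma_add Gamma_sum Gamma_square)
  qed
  then show ?thesis
    using g' h' by (auto simp: Sp_net_iff mult_in_Sp sigma_matrix_mult)
qed

lemma Sp_net_inv:
  assumes g: "g \<in> Sp_net (\<sigma>, \<Gamma>)"
  shows "matrix_inv g \<in> Sp_net (\<sigma>, \<Gamma>)"
proof -
  note g' = g[unfolded Sp_net_iff]
  then have Sp: "g \<in> Sp_carrier" by blast
  have ent: "matrix_inv g $ i $ j \<in> \<sigma> i j" for i j
    using mult_inv_iff[OF Sp, of 1 i j i j] g' sigma_swap[of j i] by (metis mult_1)
  have "row_form (matrix_inv g) i \<in> \<Gamma> i" for i
  proof -
    obtain e where "e \<in> \<sigma> i (- i)" "row_form (matrix_inv g ** g) i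
        = row_form (matrix_inv g) i + (\<Sum>k\<in>UNIV. (matrix_inv g $ i $ k)\<^sup>2 * row_form g k) + 2 * e"
      using row_form_mult_net[of "matrix_inv g" g i] g' ent by blast
    then have "row_form (matrix_inv g) i
        = - (\<Sum>k\<in>UNIV. (matrix_inv g $ i $ k)\<^sup>2 * row_form g k) + 2 * (- e)"
      by (simp add: Sp_carrierD[OF Sp] eq_neg_iff_add_eq_0 algebra_simps)
    moreover have "- (\<Sum>k\<in>UNIV. (matrix_inv g $ i $ k)\<^sup>2 * row_form g k) \<in> \<Gamma> i"
      using g' ent by (auto intro!: Gamma_uminus Gamma_sum Gamma_square)
    ultimately show ?thesis
      using \<open>e \<in> \<sigma> i (- i)\<close> by (simp add: Gamma_cong[of "- e"] sigma_uminus)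
  qed
  then show ?thesis
    using g' ent by (auto simp: Sp_net_iff matrix_inv_in_Sp)
qed

lemma subgroup_Sp_net: "subgroup (Sp_net (\<sigma>, \<Gamma>)) Sp"
proof (rule group.subgroupI[OF group_Sp])
  have "mat 1 \<in> Sp_net (\<sigma>, \<Gamma>)"
    using one_in_Sp by (simp add: Sp_net_iff Gamma_zero) (simp add: mat_def sigma_zero)
  then show "Sp_net (\<sigma>, \<Gamma>) \<noteq> {}" by blast
qed (auto simp: Sp_net_mult inv_Sp Sp_net_inv Sp_net_carrier)

lemma short_root_sigma:
  assumes "\<xi> \<in> \<sigma> i j"
  shows "short_root i j \<xi> $ k $ l \<in> \<sigma> k l"
proof -
  have "(if k = i \<and> l = j then \<xi> else 0) \<in> \<sigma> k l"
    using assms by (simp add: sigma_zero)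
  moreover have "(if k = - j \<and> l = - i then eps i * eps j * \<xi> else 0) \<in> \<sigma> k l"
    using assms by (simp add: sigma_zero sigma_swap mult.assoc)
  ultimately show ?thesis
    unfolding short_root_nth by (rule sigma_diff)
qed

lemma T_short_in_Sp_net:
  assumes "i \<noteq> j" "i \<noteq> - j" "\<xi> \<in> \<sigma> i j"
  shows "T_short i j \<xi> \<in> Sp_net (\<sigma>, \<Gamma>)"
proof -
  have "T_short i j \<xi> $ k $ l \<in> \<sigma> k l" for k l
    using sigma_add[OF _ short_root_sigma[OF assms(3)], of "mat 1 $ k $ l" k l]
    by (auto simp: T_short_eq mat_def sigma_zero)
  then show ?thesis
    by (simp add: Sp_net_iff T_short_in_Sp[OF assms(1,2)] row_form_T_short[OF assms(1,2)] Gamma_zero)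
qed

lemma T_long_in_Sp_net:
  assumes "\<alpha> \<in> \<Gamma> i"
  shows "T_long i \<alpha> \<in> Sp_net (\<sigma>, \<Gamma>)"
proof -
  have "T_long i \<alpha> $ k $ l \<in> \<sigma> k l" for k l
    using Gamma_sigma[OF assms] by (auto simp: T_long_def munit_nth mat_def sigma_zero)
  then show ?thesis
    using assms by (auto simp: Sp_net_iff T_long_in_Sp row_form_T_long Gamma_zero)
qed

lemma T_short_in_Ep_net:
  assumes "i \<noteq> j" "i \<noteq> - j" "\<xi> \<in> \<sigma> i j"
  shows "T_short i j \<xi> \<in> Ep_net (\<sigma>, \<Gamma>)"
  unfolding Ep_net_def using assms by (auto intro!: generate.incl)

lemma T_long_in_Ep_net: "\<alpha> \<in> \<Gamma> i \<Longrightarrow> T_long i \<alpha> \<in> Ep_net (\<sigma>, \<Gamma>)"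
  unfolding Ep_net_def by (auto intro!: generate.incl)

lemma Ep_net_mult: "g \<in> Ep_net (\<sigma>, \<Gamma>) \<Longrightarrow> h \<in> Ep_net (\<sigma>, \<Gamma>) \<Longrightarrow> g ** h \<in> Ep_net (\<sigma>, \<Gamma>)"
  unfolding Ep_net_def using generate.eng[of g Sp _ h] by auto

lemma Ep_net_subset: "Ep_net (\<sigma>, \<Gamma>) \<subseteq> Sp_net (\<sigma>, \<Gamma>)"
  unfolding Ep_net_def prod.case
  by (rule group.generate_subgroup_incl[OF group_Sp _ subgroup_Sp_net])
    (auto intro: T_short_in_Sp_net T_long_in_Sp_net)

text \<open>
  The smallest form parameter. Its group contains all short transvections, hence also their products,
  whose values of \<open>row_form\<close> are therefore known to be doubles without any computation of rows.
\<close>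
lemma minimal_form_net: "unitary_form_D_net \<sigma> (\<lambda>i. (*) 2 ` \<sigma> i (- i))"
proof (rule unitary_form_D_net.intro[OF _ unitary D])
  have "add_subgroup ((*) 2 ` \<sigma> i (- i))" for i
    unfolding add_subgroup_def
  proof (intro conjI ballI)
    show "0 \<in> (*) 2 ` \<sigma> i (- i)"
      by (rule image_eqI[of _ _ 0]) (simp_all add: sigma_zero)
  next
    fix x y assume "x \<in> (*) 2 ` \<sigma> i (- i)" "y \<in> (*) 2 ` \<sigma> i (- i)"
    then obtain x' y' where "x' \<in> \<sigma> i (- i)" "y' \<in> \<sigma> i (- i)" "x = 2 * x'" "y = 2 * y'" by blast
    then show "x + y \<in> (*) 2 ` \<sigma> i (- i)"
      by (intro image_eqI[of _ _ "x' + y'"]) (simp_all add: sigma_add distrib_left)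
  next
    fix x assume "x \<in> (*) 2 ` \<sigma> i (- i)"
    then obtain x' where "x' \<in> \<sigma> i (- i)" "x = 2 * x'" by blast
    then show "- x \<in> (*) 2 ` \<sigma> i (- i)"
      by (intro image_eqI[of _ _ "- x'"]) (simp_all add: sigma_uminus)
  qed
  moreover have "\<xi>\<^sup>2 * (2 * x) \<in> (*) 2 ` \<sigma> i (- i)" if "\<xi> \<in> \<sigma> i j" "x \<in> \<sigma> j (- j)" for i j \<xi> x
  proof -
    have "\<xi> * x * \<xi> \<in> \<sigma> i (- i)"
      using that by (intro sigma_mult[of _ i "- j"] sigma_mult[of _ i j]) (simp_all add: sigma_swap)
    moreover have "\<xi>\<^sup>2 * (2 * x) = 2 * (\<xi> * x * \<xi>)"
      by (simp add: power2_eq_square mult_ac)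
    ultimately show ?thesis by blast
  qed
  ultimately show "form_net (\<sigma>, \<lambda>i. (*) 2 ` \<sigma> i (- i))"
    using D sigma_scale(1) by (auto simp: form_net_def D_net_def)
qed

end

section \<open>Matrices that conjugate the net into itself\<close>

text \<open>
  The matrix of the conjugation \<open>X \<mapsto> a ** X ** b\<close> in the basis of matrix units, indexed by pairs
  and acting on row vectors; its inverse is the matrix of the conjugation by \<open>b\<close>.
\<close>
lemma invertible_tensor_square:
  fixes a b :: "'r::comm_ring_1 ^ 'k::finite ^ 'k"
  assumes ab: "a ** b = mat 1" "b ** a = mat 1"
  shows "\<exists>u. det (\<chi> s t. a $ fst t $ fst s * b $ snd s $ snd t) * u = 1"
proof -
  let ?\<Psi> = "\<chi> s t. a $ fst t $ fst s * b $ snd s $ snd t"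
  let ?\<Phi> = "\<chi> s t. b $ fst t $ fst s * a $ snd s $ snd t"
  have "(?\<Psi> ** ?\<Phi>) $ s $ t = mat 1 $ s $ t" for s t
  proof -
    have "(?\<Psi> ** ?\<Phi>) $ s $ t
        = (\<Sum>r\<in>UNIV \<times> UNIV. (b $ fst t $ fst r * a $ fst r $ fst s) * (b $ snd s $ snd r * a $ snd r $ snd t))"
      by (simp add: matrix_matrix_mult_def mult_ac)
    also have "\<dots> = (b ** a) $ fst t $ fst s * (b ** a) $ snd s $ snd t"
      by (simp add: matrix_matrix_mult_def sum_product sum.cartesian_product case_prod_unfold)
    finally show ?thesis
      by (simp add: ab mat_def) (metis prod.expand)
  qed
  then have "?\<Psi> ** ?\<Phi> = mat 1" by (simp add: vec_eq_iff)
  then have "det ?\<Psi> * det ?\<Phi> = 1"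
    unfolding det_mul[symmetric] by simp
  then show ?thesis by blast
qed

text \<open>
  Condition (T1). By \<open>inverse_net_conjugator\<close> below it passes to the inverse, so that all consequences are
  available for \<open>a\<close> and for its inverse.
\<close>
locale net_conjugator = unitary_form_D_net \<sigma> \<Gamma>
  for \<sigma> :: "'n::finite idx \<Rightarrow> 'n idx \<Rightarrow> 'r::comm_ring_1 set" and \<Gamma> +
  fixes a :: "('r, 'n) sqmat"
  assumes a: "a \<in> Sp_carrier"
    and conj_sigma: "\<xi> \<in> \<sigma> j k \<Longrightarrow> a $ i $ j * \<xi> * matrix_inv a $ k $ l \<in> \<sigma> i l"
begin

abbreviation "b \<equiv> matrix_inv a"

lemma b: "b \<in> Sp_carrier"
  by (rule matrix_inv_in_Sp(1)[OF a])

text \<open>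
  The same condition in terms of \<open>a\<close> alone: congruence instead of conjugation.
\<close>
lemma conj_sigma': "\<xi> \<in> \<sigma> j (- k) \<Longrightarrow> a $ i $ j * \<xi> * a $ l $ k \<in> \<sigma> i (- l)"
  using conj_sigma[of \<xi> j "- k" i "- l"] mult_inv_iff[OF a, of "a $ i $ j * \<xi>" "- k" "- l" i "- l"]
  by simp

lemma conj_matrix_row:
  assumes "\<And>i j. \<tau> $ i $ j \<in> \<sigma> i j"
  shows "(a ** \<tau>) $ i $ k * b $ k $ l \<in> \<sigma> i l"
proof -
  have "(a ** \<tau>) $ i $ k * b $ k $ l = (\<Sum>m\<in>UNIV. a $ i $ m * \<tau> $ m $ k * b $ k $ l)"
    by (simp add: matrix_matrix_mult_def sum_distrib_right)
  then show ?thesis by (simp add: sigma_sum conj_sigma assms)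
qed

lemma conj_matrix:
  assumes "\<And>i j. \<tau> $ i $ j \<in> \<sigma> i j"
  shows "(a ** \<tau> ** b) $ i $ l \<in> \<sigma> i l"
  unfolding matrix_matrix_mult_def[of "a ** \<tau>"]
  by (simp add: sigma_sum conj_matrix_row[OF assms])

text \<open>
  Expanding \<open>row_form b l\<close> as a sum of products of opposite entries of \<open>b\<close> distributes the product into two
  conjugated elements, one in column \<open>p\<close> and one in column \<open>- p\<close>.
\<close>
lemma mult_row_form_inv:
  assumes "x \<in> \<sigma> j l" "y \<in> \<sigma> m l"
  shows "a $ i $ j * x * (a $ i $ m * y) * row_form b l \<in> \<sigma> i (- i)"
proof -
  have "a $ i $ j * x * (a $ i $ m * y) * row_form b l
      = (\<Sum>p\<in>UNIV. (a $ i $ j * x * b $ l $ Pos p) * (a $ i $ m * y * b $ l $ (- Pos p)))"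
    by (simp add: row_form_def sum_distrib_left mult_ac)
  then show ?thesis
    by (auto intro!: sigma_sum sigma_mult_uminus[of _ i "Pos _"] conj_sigma assms)
qed

text \<open>
  Squaring an entry of \<open>a ** (mat 1 + X)\<close> is additive up to doubles, which by \<open>mult_row_form_inv\<close> stay in \<open>\<sigma> i (- i)\<close>
  after multiplication by \<open>row_form b l\<close>.
\<close>
lemma square_of_row:
  assumes X: "\<And>k l. X $ k $ l \<in> \<sigma> k l"
  shows "\<exists>e\<in>\<sigma> i (- i). ((a ** (mat 1 + X)) $ i $ l)\<^sup>2 * row_form b l = (a $ i $ l)\<^sup>2 * row_form b l
    + (\<Sum>k\<in>UNIV. (a $ i $ k)\<^sup>2 * (X $ k $ l)\<^sup>2 * row_form b l) + 2 * e"
proof -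
  let ?s = "row_form b l"
  obtain e where e: "e * ?s \<in> \<sigma> i (- i)" "(\<Sum>k\<in>UNIV. a $ i $ k * X $ k $ l)\<^sup>2
      = (\<Sum>k\<in>UNIV. (a $ i $ k * X $ k $ l)\<^sup>2) + 2 * e"
    using square_of_sum[OF finite add_subgroup_sigma_quotient, of "\<lambda>k. a $ i $ k * X $ k $ l" "row_form b l" i "- i" UNIV]
      mult_row_form_inv[OF X X] by auto
  define f where "f = (\<Sum>k\<in>UNIV. a $ i $ l * (a $ i $ k * X $ k $ l) * ?s)"
  have f: "f \<in> \<sigma> i (- i)"
    unfolding f_def using mult_row_form_inv[of 1 l l "X $ _ $ l"] X by (auto intro!: sigma_sum)
  have f': "f = a $ i $ l * (\<Sum>k\<in>UNIV. a $ i $ k * X $ k $ l) * ?s"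
    by (simp add: f_def sum_distrib_left sum_distrib_right)
  have "(a ** (mat 1 + X)) $ i $ l = a $ i $ l + (\<Sum>k\<in>UNIV. a $ i $ k * X $ k $ l)"
    by (simp add: matrix_bilinear) (simp add: matrix_matrix_mult_def)
  then have "((a ** (mat 1 + X)) $ i $ l)\<^sup>2 * ?s = (a $ i $ l)\<^sup>2 * ?s
      + (\<Sum>k\<in>UNIV. a $ i $ k * X $ k $ l)\<^sup>2 * ?s + 2 * f"
    by (simp add: f' power2_sum algebra_simps)
  also have "\<dots> = (a $ i $ l)\<^sup>2 * ?s + (\<Sum>k\<in>UNIV. (a $ i $ k)\<^sup>2 * (X $ k $ l)\<^sup>2 * ?s) + 2 * (e * ?s + f)"
    unfolding e(2) power_mult_distrib sum_distrib_right[symmetric] by (simp add: algebra_simps)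
  finally show ?thesis using sigma_add[OF e(1) f] by blast
qed

text \<open>
  The multiplication law for the product of \<open>a\<close> and its inverse, where the left-hand side vanishes.
\<close>
lemma row_form_self:
  "\<exists>e\<in>\<sigma> i (- i). row_form a i = - (\<Sum>k\<in>UNIV. (a $ i $ k)\<^sup>2 * row_form b k) + 2 * e"
proof -
  have "(a $ i $ k * b $ k $ p) * (a $ i $ l * b $ l $ (- p)) \<in> \<sigma> i (- i)" for k l p
    using conj_sigma[of 1] by (intro sigma_mult_uminus[of _ i p]) (metis mult.right_neutral sigma_diag)+
  then obtain e where e: "e \<in> \<sigma> i (- i)"
    "row_form (a ** b) i = row_form a i + (\<Sum>k\<in>UNIV. (a $ i $ k)\<^sup>2 * row_form b k) + 2 * e"
    using row_form_mult[OF b sigma_group, of a i i "- i"] by blast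
  then have "row_form a i = - (\<Sum>k\<in>UNIV. (a $ i $ k)\<^sup>2 * row_form b k) + 2 * (- e)"
    by (simp add: Sp_carrierD[OF a] eq_neg_iff_add_eq_0 algebra_simps)
  then show ?thesis using sigma_uminus[OF e(1)] by blast
qed

text \<open>
  The multiplication law applied twice, to \<open>(a ** \<tau>) ** b\<close> and to \<open>a ** \<tau>\<close>. The terms that do not involve \<open>\<tau>\<close> are
  those of \<open>a ** b\<close> and cancel by \<open>row_form_self\<close>; this is why only \<open>\<tau> - mat 1\<close> occurs in the double sum.
\<close>
lemma row_form_conj:
  assumes \<tau>: "\<tau> \<in> Sp_carrier" "\<And>k l. \<tau> $ k $ l \<in> \<sigma> k l"
  shows "\<exists>e\<in>\<sigma> i (- i). row_form (a ** \<tau> ** b) i = (\<Sum>k\<in>UNIV. (a $ i $ k)\<^sup>2 * row_form \<tau> k)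
    + (\<Sum>l\<in>UNIV. \<Sum>k\<in>UNIV. (a $ i $ k)\<^sup>2 * ((\<tau> - mat 1) $ k $ l)\<^sup>2 * row_form b l) + 2 * e"
proof -
  let ?X = "\<tau> - mat 1"
  have "((a ** \<tau>) $ i $ k * b $ k $ p) * ((a ** \<tau>) $ i $ l * b $ l $ (- p)) \<in> \<sigma> i (- i)" for k l p
    by (intro sigma_mult_uminus[of _ i p] conj_matrix_row \<tau>)
  then obtain e1 where e1: "e1 \<in> \<sigma> i (- i)" "row_form (a ** \<tau> ** b) i
      = row_form (a ** \<tau>) i + (\<Sum>l\<in>UNIV. ((a ** \<tau>) $ i $ l)\<^sup>2 * row_form b l) + 2 * e1"
    using row_form_mult[OF b sigma_group, of "a ** \<tau>" i i "- i"] by blast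
  have "(a $ i $ k * \<tau> $ k $ p) * (a $ i $ l * \<tau> $ l $ (- p)) \<in> \<sigma> i (- i)" for k l p
  proof -
    have "\<tau> $ k $ p * \<tau> $ l $ (- p) \<in> \<sigma> k (- l)"
      using \<tau>(2)[of l "- p"] by (intro sigma_mult[of _ k p] \<tau>(2)) (simp add: sigma_swap_uminus)
    from conj_sigma'[OF this, of i i] show ?thesis by (simp add: mult_ac)
  qed
  then obtain e2 where e2: "e2 \<in> \<sigma> i (- i)" "row_form (a ** \<tau>) i
      = row_form a i + (\<Sum>k\<in>UNIV. (a $ i $ k)\<^sup>2 * row_form \<tau> k) + 2 * e2"
    using row_form_mult[OF \<tau>(1) sigma_group, of a i i "- i"] by blast
  obtain e3 where e3: "e3 \<in> \<sigma> i (- i)"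
    "row_form a i = - (\<Sum>k\<in>UNIV. (a $ i $ k)\<^sup>2 * row_form b k) + 2 * e3"
    using row_form_self by blast
  have "?X $ k $ l \<in> \<sigma> k l" for k l
    using \<tau>(2)[of k l] by (auto simp: mat_def sigma_zero intro!: sigma_diff)
  from square_of_row[OF this] have "\<forall>l. \<exists>e. e \<in> \<sigma> i (- i) \<and>
      ((a ** \<tau>) $ i $ l)\<^sup>2 * row_form b l = (a $ i $ l)\<^sup>2 * row_form b l
      + (\<Sum>k\<in>UNIV. (a $ i $ k)\<^sup>2 * (?X $ k $ l)\<^sup>2 * row_form b l) + 2 * e"
    by (simp add: Bex_def)
  from choice[OF this] obtain f where f: "\<And>l. f l \<in> \<sigma> i (- i)" "\<And>l. ((a ** \<tau>) $ i $ l)\<^sup>2 * row_form b l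
      = (a $ i $ l)\<^sup>2 * row_form b l
        + (\<Sum>k\<in>UNIV. (a $ i $ k)\<^sup>2 * (?X $ k $ l)\<^sup>2 * row_form b l) + 2 * f l"
    by blast
  have "row_form (a ** \<tau> ** b) i = (\<Sum>k\<in>UNIV. (a $ i $ k)\<^sup>2 * row_form \<tau> k)
    + (\<Sum>l\<in>UNIV. \<Sum>k\<in>UNIV. (a $ i $ k)\<^sup>2 * (?X $ k $ l)\<^sup>2 * row_form b l)
    + 2 * (e1 + e2 + e3 + (\<Sum>l\<in>UNIV. f l))"
    unfolding e1(2) e2(2) e3(2) f(2) sum.distrib sum_distrib_left[symmetric]
    by (simp add: algebra_simps)
  moreover have "e1 + e2 + e3 + (\<Sum>l\<in>UNIV. f l) \<in> \<sigma> i (- i)"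
    by (intro sigma_add sigma_sum e1 e2 e3 f)
  ultimately show ?thesis by blast
qed

lemma conj_in_Sp_net:
  assumes T2: "\<And>i j k \<xi>. \<xi> \<in> \<sigma> j k \<Longrightarrow> (a $ i $ j)\<^sup>2 * \<xi>\<^sup>2 * row_form b k \<in> \<Gamma> i"
    and T3: "\<And>i j \<alpha>. \<alpha> \<in> \<Gamma> j \<Longrightarrow> (a $ i $ j)\<^sup>2 * \<alpha> \<in> \<Gamma> i"
    and \<tau>: "\<tau> \<in> Sp_net (\<sigma>, \<Gamma>)"
  shows "a ** \<tau> ** b \<in> Sp_net (\<sigma>, \<Gamma>)"
proof -
  have \<tau>': "\<tau> \<in> Sp_carrier" "\<And>k l. \<tau> $ k $ l \<in> \<sigma> k l" "\<And>k. row_form \<tau> k \<in> \<Gamma> k"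
    using \<tau>[unfolded Sp_net_iff] by blast+
  have X: "(\<tau> - mat 1) $ k $ l \<in> \<sigma> k l" for k l
    using \<tau>'(2)[of k l] by (auto simp: mat_def sigma_zero intro!: sigma_diff)
  have "row_form (a ** \<tau> ** b) i \<in> \<Gamma> i" for i
  proof -
    obtain e where "e \<in> \<sigma> i (- i)" "row_form (a ** \<tau> ** b) i
      = (\<Sum>k\<in>UNIV. (a $ i $ k)\<^sup>2 * row_form \<tau> k)
        + (\<Sum>l\<in>UNIV. \<Sum>k\<in>UNIV. (a $ i $ k)\<^sup>2 * ((\<tau> - mat 1) $ k $ l)\<^sup>2 * row_form b l) + 2 * e"
      using row_form_conj[OF \<tau>'(1,2)] by blast
    moreover have "(\<Sum>k\<in>UNIV. (a $ i $ k)\<^sup>2 * row_form \<tau> k)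
        + (\<Sum>l\<in>UNIV. \<Sum>k\<in>UNIV. (a $ i $ k)\<^sup>2 * ((\<tau> - mat 1) $ k $ l)\<^sup>2 * row_form b l) \<in> \<Gamma> i"
      by (intro Gamma_add Gamma_sum T2 T3 X \<tau>')
    ultimately show ?thesis using Gamma_cong by blast
  qed
  then show ?thesis
    by (simp add: Sp_net_iff mult_in_Sp a b \<tau>' conj_matrix)
qed

lemma row_form_in_Gamma:
  assumes T2: "\<And>i j k \<xi>. \<xi> \<in> \<sigma> j k \<Longrightarrow> (a $ i $ j)\<^sup>2 * \<xi>\<^sup>2 * row_form b k \<in> \<Gamma> i"
  shows "row_form a i \<in> \<Gamma> i"
proof -
  have "(a $ i $ k)\<^sup>2 * row_form b k \<in> \<Gamma> i" for k
    using T2[of 1 k k i] by simp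
  then have "- (\<Sum>k\<in>UNIV. (a $ i $ k)\<^sup>2 * row_form b k) \<in> \<Gamma> i"
    by (intro Gamma_uminus Gamma_sum)
  then show ?thesis using row_form_self[of i] Gamma_cong by blast
qed

section \<open>Passing to the inverse\<close>

text \<open>
  Conjugation by \<open>a\<close> is an invertible linear map of a free module of finite rank which maps the matrices
  with entries in \<open>\<sigma>\<close> to themselves. Its determinant is a unit, so by \<open>det_mult_preimage\<close> the inverse map does the same.
\<close>
lemma inverse_net_conjugator: "net_conjugator \<sigma> \<Gamma> b"
proof (unfold_locales)
  show "b \<in> Sp_carrier" by (rule b)
next
  fix x p q j k
  assume x: "x \<in> \<sigma> p q"
  (* y is the matrix b ** munit p q x ** a; its conjugate by a is munit p q x. *)
  let ?\<Psi> = "\<chi> s t. a $ fst t $ fst s * b $ snd s $ snd t"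
  let ?y = "\<chi> s. b $ fst s $ p * x * a $ q $ snd s"
  let ?P = "\<lambda>s. \<sigma> (fst s) (snd s)"
  have "(?y v* ?\<Psi>) $ t \<in> ?P t" for t
  proof -
    have "(?y v* ?\<Psi>) $ t
        = (\<Sum>r\<in>UNIV \<times> UNIV. (a $ fst t $ fst r * b $ fst r $ p) * (a $ q $ snd r * b $ snd r $ snd t)) * x"
      by (simp add: vector_matrix_mult_def sum_distrib_left mult_ac)
    also have "\<dots> = (a ** b) $ fst t $ p * (a ** b) $ q $ snd t * x"
      by (simp add: matrix_matrix_mult_def sum_product sum.cartesian_product case_prod_unfold)
    finally show ?thesis
      using x by (auto simp: Sp_carrierD[OF a] mat_def sigma_zero)
  qed
  then have "?y $ (j, k) * det ?\<Psi> \<in> ?P (j, k)"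
    by (intro det_mult_preimage sigma_group) (auto simp: sigma_scale mult_ac conj_sigma[simplified mult_ac])
  moreover obtain u where "det ?\<Psi> * u = 1"
    using invertible_tensor_square[OF Sp_carrierD(1,2)[OF a]] by blast
  ultimately have "?y $ (j, k) \<in> \<sigma> j k"
    using sigma_scale(2)[of "?y $ (j, k) * det ?\<Psi>" j k u] by (simp add: mult.assoc)
  then show "b $ j $ p * x * matrix_inv b $ q $ k \<in> \<sigma> j k"
    by (simp add: matrix_inv_in_Sp(2)[OF a])
qed

text \<open>
  Let \<open>Q\<close> be the matrix of the squares of the entries of \<open>a\<close>, and \<open>Q'\<close> that of its inverse \<open>b\<close>. Both act on families of
  elements of the ideals \<open>\<sigma> i (- i)\<close>, and modulo doubles they are inverse to each other. By (T3) \<open>Q\<close> preserves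
  the family \<open>\<Gamma>\<close>; hence so does \<open>Q'\<close> after multiplication by the determinant of \<open>Q\<close>. The latter is the square of
  a unit plus an even element. The even part is harmless because \<open>Q'\<close> preserves the family of ideals,
  and a unit square can be cancelled because \<open>\<Gamma>\<close> is stable under squares of ring elements.
\<close>
lemma inverse_T3:
  assumes T3: "\<And>i j \<alpha>. \<alpha> \<in> \<Gamma> j \<Longrightarrow> (a $ i $ j)\<^sup>2 * \<alpha> \<in> \<Gamma> i" and \<alpha>: "\<alpha> \<in> \<Gamma> j"
  shows "(b $ i $ j)\<^sup>2 * \<alpha> \<in> \<Gamma> i"
proof -
  interpret inv: net_conjugator \<sigma> \<Gamma> b by (rule inverse_net_conjugator)
  let ?\<Psi> = "\<chi> k i. (a $ i $ k)\<^sup>2"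
  let ?y = "\<chi> k. (b $ k $ j)\<^sup>2 * \<alpha>"
  have b\<alpha>b: "b $ k $ j * \<alpha> * b $ l $ j \<in> \<sigma> k (- l)" for k l
    by (rule inv.conj_sigma'[OF Gamma_sigma[OF \<alpha>]])
  have "(?y v* ?\<Psi>) $ m \<in> \<Gamma> m" for m
  proof -
    have "a $ m $ k * b $ k $ j * (a $ m $ l * b $ l $ j) * \<alpha> \<in> \<sigma> m (- m)" for k l
      using conj_sigma'[OF b\<alpha>b[of k l], of m m] by (simp add: mult_ac)
    then obtain e where e: "e * \<alpha> \<in> \<sigma> m (- m)" "(\<Sum>k\<in>UNIV. a $ m $ k * b $ k $ j)\<^sup>2
        = (\<Sum>k\<in>UNIV. (a $ m $ k * b $ k $ j)\<^sup>2) + 2 * e"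
      using square_of_sum[OF finite add_subgroup_sigma_quotient, of "\<lambda>k. a $ m $ k * b $ k $ j" \<alpha> m "- m" UNIV] by auto
    have "(\<Sum>k\<in>UNIV. a $ m $ k * b $ k $ j) = (if m = j then 1 else 0)"
      using Sp_carrierD(1)[OF a] by (simp add: matrix_matrix_mult_def mat_def vec_eq_iff)
    then have "(\<Sum>k\<in>UNIV. a $ m $ k * b $ k $ j)\<^sup>2 * \<alpha> \<in> \<Gamma> m"
      using \<alpha> by (simp add: Gamma_zero)
    moreover have "(\<Sum>k\<in>UNIV. a $ m $ k * b $ k $ j)\<^sup>2 * \<alpha> = (?y v* ?\<Psi>) $ m + 2 * (e * \<alpha>)"
    proof -
      have "(?y v* ?\<Psi>) $ m = (\<Sum>k\<in>UNIV. (a $ m $ k * b $ k $ j)\<^sup>2) * \<alpha>"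
        by (simp add: vector_matrix_mult_def sum_distrib_left power_mult_distrib mult_ac)
      then show ?thesis unfolding e(2) by (simp add: algebra_simps)
    qed
    ultimately show ?thesis using Gamma_cong[OF e(1)] by blast
  qed
  then have in_Gamma: "?y $ i * det ?\<Psi> \<in> \<Gamma> i"
    using T3 Gamma_square[OF sigma_diag]
    by (intro det_mult_preimage[of \<Gamma> ?\<Psi> ?y i] Gamma_group) (simp_all add: mult.commute)
  have "?\<Psi> = (\<chi> k i. (transpose a $ k $ i)\<^sup>2)"
    by (simp add: transpose_def)
  then obtain r where r: "det ?\<Psi> = (det a)\<^sup>2 + 2 * r"
    using det_of_squares[of "transpose a"] by auto
  have "?y $ i \<in> \<sigma> i (- i)"
    using b\<alpha>b[of i i] by (simp add: power2_eq_square mult_ac)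
  then have "?y $ i * r \<in> \<sigma> i (- i)" by (rule sigma_scale)
  then have "?y $ i * det ?\<Psi> \<in> \<Gamma> i \<longleftrightarrow> (det a)\<^sup>2 * ?y $ i \<in> \<Gamma> i"
    by (rule Gamma_cong) (simp only: r, simp add: algebra_simps)
  with in_Gamma have "(det a)\<^sup>2 * ?y $ i \<in> \<Gamma> i" by blast
  then have "(det b)\<^sup>2 * ((det a)\<^sup>2 * ?y $ i) \<in> \<Gamma> i"
    by (rule Gamma_square[OF sigma_diag])
  moreover have "det b * det a = 1"
    unfolding det_mul[symmetric] by (simp add: Sp_carrierD(2)[OF a])
  then have "(det b)\<^sup>2 * ((det a)\<^sup>2 * z) = z" for z
    by (simp flip: mult.assoc power_mult_distrib)
  ultimately show ?thesis by simp
qed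

end

section \<open>Transporters of the elementary group\<close>

text \<open>
  Three of the four products of matrix units vanish, so the product of two short roots is a single
  matrix unit. The case \<open>k = - j\<close> is included and gives a long root.
\<close>
lemma short_root_mult:
  fixes j h k :: "'n::finite idx"
  assumes "j \<noteq> h" "j \<noteq> - h" "h \<noteq> k" "h \<noteq> - k" "j \<noteq> k"
  shows "short_root j h \<xi> ** short_root h k \<zeta> = munit j k (\<xi> * \<zeta> :: 'r::comm_ring_1)"
proof -
  have "- j \<noteq> h" using assms(2) by (metis uminus_uminus_idx)
  then show ?thesis
    using assms by (simp add: short_root_def matrix_bilinear munit_mult)
qed

text \<open>
  The equivalence relation enters only through the equalities \<open>\<sigma>\<^sub>i\<^sub>j = R\<close> for equivalent \<open>i\<close>, \<open>j\<close>
  and \<open>\<Gamma>\<^sub>i = R\<close> for equivalent \<open>i\<close>, \<open>- i\<close>, together with the existence of auxiliary indices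
  in a class of at least three elements.
\<close>
locale class_net = unitary_form_D_net \<sigma> \<Gamma>
  for \<sigma> :: "'n::finite idx \<Rightarrow> 'n idx \<Rightarrow> 'r::comm_ring_1 set" and \<Gamma> +
  fixes \<nu> :: "('n idx \<times> 'n idx) set"
  assumes equiv: "equiv UNIV \<nu>" and unitary_\<nu>: "unitary_rel \<nu>"
    and classes: "C \<in> UNIV // \<nu> \<Longrightarrow> 3 \<le> card C"
    and \<nu>_le: "form_net_le (rel_form_net \<nu>) (\<sigma>, \<Gamma>)"
begin

lemma sigma_class: "(i, j) \<in> \<nu> \<Longrightarrow> x \<in> \<sigma> i j"
  and Gamma_class: "(i, - i) \<in> \<nu> \<Longrightarrow> x \<in> \<Gamma> i"
proof -
  have "(if (i, j) \<in> \<nu> then UNIV else {0}) \<subseteq> \<sigma> i j" "(if (i, - i) \<in> \<nu> then UNIV else {0}) \<subseteq> \<Gamma> i"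
    using \<nu>_le by (simp_all add: form_net_le_def rel_form_net_def)
  then show "(i, j) \<in> \<nu> \<Longrightarrow> x \<in> \<sigma> i j" and "(i, - i) \<in> \<nu> \<Longrightarrow> x \<in> \<Gamma> i" by auto
qed

lemma \<nu>_sym: "(i, j) \<in> \<nu> \<Longrightarrow> (j, i) \<in> \<nu>"
  and \<nu>_trans: "(i, j) \<in> \<nu> \<Longrightarrow> (j, k) \<in> \<nu> \<Longrightarrow> (i, k) \<in> \<nu>"
  and \<nu>_uminus: "(i, j) \<in> \<nu> \<Longrightarrow> (- i, - j) \<in> \<nu>"
  using equiv unitary_\<nu> unfolding equiv_def unitary_rel_def by (blast dest: symD transD)+

lemma sigma_class_left: "(i, j) \<in> \<nu> \<Longrightarrow> x \<in> \<sigma> j k \<Longrightarrow> x \<in> \<sigma> i k"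
  using sigma_mult[OF sigma_class[of i j 1], of x k] by simp

lemma class_not_subset:
  assumes "card S < 3" "finite S"
  shows "\<exists>h. (j, h) \<in> \<nu> \<and> h \<notin> S"
proof -
  have "3 \<le> card (\<nu> `` {j})"
    by (rule classes) (simp add: quotientI)
  then have "\<not> \<nu> `` {j} \<subseteq> S"
    using card_mono[OF assms(2), of "\<nu> `` {j}"] assms(1) by linarith
  then show ?thesis by auto
qed

lemma class_neighbour:
  obtains h where "(j, h) \<in> \<nu>" "j \<noteq> h" "j \<noteq> - h" "h \<noteq> - j"
proof -
  have "card {j, - j} < 3" by (simp add: card_insert_if)
  then obtain h where "(j, h) \<in> \<nu>" "h \<notin> {j, - j}" using class_not_subset by blast
  then show thesis using that[of h] by (metis insertCI uminus_uminus_idx)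
qed

text \<open>
  If \<open>j\<close> and \<open>- j\<close> are not equivalent, then by unitarity the class of \<open>j\<close> contains no pair of opposite indices at all.
\<close>
lemma class_triangle:
  assumes "(j, - j) \<notin> \<nu>"
  obtains h h' where "(j, h) \<in> \<nu>" "(j, h') \<in> \<nu>" "h \<noteq> j" "h \<noteq> - j" "h' \<noteq> j" "h' \<noteq> - j" "h \<noteq> h'" "h \<noteq> - h'"
proof -
  obtain h where h: "(j, h) \<in> \<nu>" "j \<noteq> h" "h \<noteq> - j" by (rule class_neighbour)
  have "card {j, h} < 3" by (simp add: card_insert_if)
  then obtain h' where h': "(j, h') \<in> \<nu>" "h' \<notin> {j, h}" using class_not_subset by blast
  have "h \<noteq> - h'"
  proof
    assume "h = - h'"
    then have "(- j, h') \<in> \<nu>" using \<nu>_uminus[OF h(1)] by simp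
    then show False using assms \<nu>_trans[OF h'(1) \<nu>_sym] by blast
  qed
  then show thesis using that[of h h'] h h' assms by auto
qed

end

locale net_transporter = class_net \<sigma> \<Gamma> \<nu>
  for \<sigma> :: "'n::finite idx \<Rightarrow> 'n idx \<Rightarrow> 'r::comm_ring_1 set" and \<Gamma> \<nu> +
  fixes a :: "('r, 'n) sqmat"
  assumes a_in_Sp: "a \<in> Sp_carrier"
    and transport: "\<tau> \<in> Ep_net (\<sigma>, \<Gamma>) \<Longrightarrow> a ** \<tau> ** matrix_inv a \<in> Sp_net (\<sigma>, \<Gamma>)"
begin

text \<open>
  These matrices form a ring, because the matrices with entries in \<open>\<sigma>\<close> do, and condition (T1) says that
  all matrices \<open>munit j k \<xi>\<close> with \<open>\<xi> \<in> \<sigma> j k\<close> belong to it.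
\<close>
definition conj_net :: "('r, 'n) sqmat \<Rightarrow> bool" where
  "conj_net X \<longleftrightarrow> (\<forall>i l. (a ** X ** matrix_inv a) $ i $ l \<in> \<sigma> i l)"

lemma conj_net_mult:
  assumes "conj_net X" "conj_net Y"
  shows "conj_net (X ** Y)"
proof -
  have "a ** (X ** Y) ** matrix_inv a = a ** X ** (matrix_inv a ** a) ** Y ** matrix_inv a"
    by (simp add: Sp_carrierD(2)[OF a_in_Sp] matrix_mul_assoc)
  also have "\<dots> = (a ** X ** matrix_inv a) ** (a ** Y ** matrix_inv a)"
    by (simp only: matrix_mul_assoc)
  finally show ?thesis
    using assms sigma_matrix_mult unfolding conj_net_def by metis
qed

lemma conj_net_diff_one:
  assumes "mat 1 + X \<in> Ep_net (\<sigma>, \<Gamma>)"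
  shows "conj_net X"
proof -
  have "a ** (mat 1 + X) ** matrix_inv a = mat 1 + a ** X ** matrix_inv a"
    by (simp add: matrix_bilinear Sp_carrierD(1)[OF a_in_Sp])
  then have "(a ** X ** matrix_inv a) $ i $ l
      = (a ** (mat 1 + X) ** matrix_inv a) $ i $ l - mat 1 $ i $ l" for i l
    by simp
  moreover have "(a ** (mat 1 + X) ** matrix_inv a) $ i $ l \<in> \<sigma> i l" for i l
    using transport[OF assms] by (simp add: Sp_net_iff)
  moreover have "mat 1 $ i $ l \<in> \<sigma> i l" for i l
    by (simp add: mat_def sigma_zero)
  ultimately show ?thesis by (simp add: conj_net_def sigma_diff)
qed

lemma conj_net_short_root: "j \<noteq> k \<Longrightarrow> j \<noteq> - k \<Longrightarrow> \<xi> \<in> \<sigma> j k \<Longrightarrow> conj_net (short_root j k \<xi>)"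
  by (rule conj_net_diff_one) (use T_short_in_Ep_net in \<open>simp add: T_short_eq\<close>)

lemma conj_net_long_root: "\<alpha> \<in> \<Gamma> j \<Longrightarrow> conj_net (munit j (- j) \<alpha>)"
  by (rule conj_net_diff_one) (use T_long_in_Ep_net in \<open>simp add: T_long_def\<close>)

lemma conj_net_munit_via:
  assumes "j \<noteq> h" "j \<noteq> - h" "h \<noteq> k" "h \<noteq> - k" "j \<noteq> k" "(j, h) \<in> \<nu>" "\<xi> \<in> \<sigma> j k"
  shows "conj_net (munit j k \<xi>)"
proof -
  have "conj_net (short_root j h 1 ** short_root h k \<xi>)"
    using assms sigma_class_left[OF \<nu>_sym[OF assms(6)] assms(7)] sigma_class[OF assms(6)]
    by (intro conj_net_mult conj_net_short_root) auto
  then show ?thesis using short_root_mult[OF assms(1-5), of 1 \<xi>] by simp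
qed

text \<open>
  If \<open>j\<close> and \<open>- j\<close> are equivalent, the product of two opposite long roots is diagonal. Otherwise there are
  indices \<open>h\<close>, \<open>h'\<close> in the class of \<open>j\<close>, and the detour via \<open>h'\<close> isolates the matrix units \<open>e\<^sub>j\<^sub>h\<close> and \<open>e\<^sub>h\<^sub>j\<close>.
\<close>
lemma conj_net_diagonal: "conj_net (munit j j 1)"
proof (cases "(j, - j) \<in> \<nu>")
  case True
  then have "conj_net (munit j (- j) 1 ** munit (- j) (- (- j)) 1)"
    using Gamma_class[OF True] Gamma_class[of "- j"] \<nu>_sym[OF True]
    by (intro conj_net_mult conj_net_long_root) auto
  then show ?thesis by (simp add: munit_mult)
next
  case False
  then obtain h h' where h: "(j, h) \<in> \<nu>" "(j, h') \<in> \<nu>" "h \<noteq> j" "h \<noteq> - j" "h' \<noteq> j" "h' \<noteq> - j"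
      "h \<noteq> h'" "h \<noteq> - h'"
    by (rule class_triangle)
  then have h': "j \<noteq> - h" "j \<noteq> - h'" "h' \<noteq> - h" by (metis uminus_uminus_idx)+
  have "conj_net (munit j h 1)"
    using h h' sigma_class by (intro conj_net_munit_via[of j h' h]) auto
  moreover have "conj_net (munit h j 1)"
    using h h' sigma_class[OF \<nu>_sym[OF h(1)]] \<nu>_trans[OF \<nu>_sym[OF h(1)] h(2)]
    by (intro conj_net_munit_via[of h h' j]) auto
  ultimately have "conj_net (munit j h 1 ** munit h j 1)" by (rule conj_net_mult)
  then show ?thesis by (simp add: munit_mult)
qed

text \<open>
  Multiplication by a diagonal matrix unit from the left cuts one matrix unit out of a short root. The
  long positions are reached through a neighbour of \<open>j\<close> in its class.
\<close>
lemma conj_net_munit: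
  assumes "\<xi> \<in> \<sigma> j k"
  shows "conj_net (munit j k \<xi>)"
proof -
  consider "k = j" | "k = - j" | "j \<noteq> k" "j \<noteq> - k" by (metis uminus_uminus_idx)
  then show ?thesis
  proof cases
    case 1
    have "a $ i $ j * \<xi> * matrix_inv a $ j $ l = \<xi> * (a $ i $ j * 1 * matrix_inv a $ j $ l)" for i l
      by simp
    then show ?thesis
      using conj_net_diagonal[of j] unfolding 1 conj_net_def conj_munit_nth by (metis sigma_scale(1))
  next
    case 2
    obtain h where "(j, h) \<in> \<nu>" "j \<noteq> h" "j \<noteq> - h" "h \<noteq> - j" by (rule class_neighbour)
    then show ?thesis
      using assms unfolding 2 by (intro conj_net_munit_via[of j h]) auto
  next
    case 3
    have "conj_net (munit j j 1 ** short_root j k \<xi>)"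
      by (intro conj_net_mult conj_net_diagonal conj_net_short_root 3 assms)
    then show ?thesis using 3 by (simp add: short_root_def matrix_bilinear munit_mult)
  qed
qed

sublocale net_conjugator \<sigma> \<Gamma> a
  by unfold_locales (use conj_net_munit in \<open>auto simp: a_in_Sp conj_net_def conj_munit_nth\<close>)

text \<open>
  The double sum of \<open>row_form_conj\<close>, as a function of \<open>X = \<tau> - mat 1\<close>. It is built from the squares of
  single entries, so on matrices with entries in \<open>\<sigma>\<close> it is additive modulo \<open>\<Gamma> i\<close>.
\<close>
definition defect :: "'n idx \<Rightarrow> ('r, 'n) sqmat \<Rightarrow> 'r" where
  "defect i X = (\<Sum>l\<in>UNIV. \<Sum>k\<in>UNIV. (a $ i $ k)\<^sup>2 * (X $ k $ l)\<^sup>2 * row_form b l)"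

definition negligible :: "'n idx \<Rightarrow> ('r, 'n) sqmat \<Rightarrow> bool" where
  "negligible i X \<longleftrightarrow> (\<forall>k l. X $ k $ l \<in> \<sigma> k l) \<and> defect i X \<in> \<Gamma> i"

lemma negligible_add:
  assumes "negligible i X" "negligible i Y"
  shows "negligible i (X + Y)"
proof -
  define e where "e = (\<Sum>l\<in>UNIV. \<Sum>k\<in>UNIV. a $ i $ k * X $ k $ l * (a $ i $ k * Y $ k $ l) * row_form b l)"
  have "e \<in> \<sigma> i (- i)"
    unfolding e_def using assms by (auto simp: negligible_def intro!: sigma_sum mult_row_form_inv)
  moreover have "defect i (X + Y) = (defect i X + defect i Y) + 2 * e"
    unfolding defect_def e_def sum.distrib[symmetric] sum_distrib_left
    by (intro sum.cong refl) (simp add: power2_eq_square algebra_simps)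
  ultimately have "defect i (X + Y) \<in> \<Gamma> i"
    using Gamma_cong[of e i "defect i (X + Y)" "defect i X + defect i Y"] Gamma_add assms
    by (simp add: negligible_def)
  then show ?thesis using assms by (simp add: negligible_def sigma_add)
qed

lemma negligible_diff:
  assumes "negligible i X" "negligible i Y"
  shows "negligible i (X - Y)"
proof -
  have "negligible i (- Y)"
    using assms(2) by (simp add: negligible_def defect_def sigma_uminus)
  from negligible_add[OF assms(1) this] show ?thesis by simp
qed

lemma negligible_munitD:
  assumes "negligible i (munit j k \<xi>)"
  shows "(a $ i $ j)\<^sup>2 * \<xi>\<^sup>2 * row_form b k \<in> \<Gamma> i"
proof -
  have "defect i (munit j k \<xi>) = (\<Sum>l\<in>UNIV. \<Sum>m\<in>UNIV. if m = j then
      (if l = k then (a $ i $ j)\<^sup>2 * \<xi>\<^sup>2 * row_form b k else 0) else 0)"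
    unfolding defect_def by (intro sum.cong refl) (auto simp: munit_nth)
  then show ?thesis using assms by (simp add: negligible_def)
qed

text \<open>
  By \<open>row_form_conj\<close>, this is what the transporter condition says about the form parameter.
\<close>
lemma transport_row_form:
  assumes "\<tau> \<in> Ep_net (\<sigma>, \<Gamma>)"
  shows "(\<Sum>k\<in>UNIV. (a $ i $ k)\<^sup>2 * row_form \<tau> k) + defect i (\<tau> - mat 1) \<in> \<Gamma> i"
proof -
  have \<tau>: "\<tau> \<in> Sp_carrier" "\<And>k l. \<tau> $ k $ l \<in> \<sigma> k l"
    using assms Ep_net_subset by (auto simp: Sp_net_iff)
  have "row_form (a ** \<tau> ** b) i \<in> \<Gamma> i"
    using transport[OF assms] by (simp add: Sp_net_iff)
  then show ?thesis
    using row_form_conj[OF \<tau>, of i] Gamma_cong unfolding defect_def by blast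
qed

interpretation minimal: unitary_form_D_net \<sigma> "\<lambda>i. (*) 2 ` \<sigma> i (- i)"
  by (rule minimal_form_net)

abbreviation "short_net \<equiv> Sp_net (\<sigma>, \<lambda>i. (*) 2 ` \<sigma> i (- i))"

text \<open>
  On a product of short transvections all values of \<open>row_form\<close> are doubles, so only the \<open>defect\<close> remains.
\<close>
lemma negligible_short:
  assumes "\<tau> \<in> Ep_net (\<sigma>, \<Gamma>)" "\<tau> \<in> short_net"
  shows "negligible i (\<tau> - mat 1)"
proof -
  have "(a $ i $ k)\<^sup>2 * row_form \<tau> k \<in> \<Gamma> i" for k
  proof -
    obtain x where x: "x \<in> \<sigma> k (- k)" "row_form \<tau> k = 2 * x"
      using assms(2)[unfolded minimal.Sp_net_iff] by blast
    have "2 * (a $ i $ k * x * a $ i $ k) \<in> \<Gamma> i"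
      by (rule Gamma_double[OF conj_sigma'[OF x(1)]])
    then show ?thesis by (simp add: x(2) power2_eq_square mult_ac)
  qed
  then have "(\<Sum>k\<in>UNIV. (a $ i $ k)\<^sup>2 * row_form \<tau> k) \<in> \<Gamma> i" by (rule Gamma_sum)
  from Gamma_diff[OF transport_row_form[OF assms(1)] this] have "defect i (\<tau> - mat 1) \<in> \<Gamma> i" by simp
  moreover have "(\<tau> - mat 1) $ k $ l \<in> \<sigma> k l" for k l
  proof -
    have "\<tau> $ k $ l \<in> \<sigma> k l" using assms(2) by (simp add: minimal.Sp_net_iff)
    then show ?thesis by (auto simp: mat_def sigma_zero intro!: sigma_diff)
  qed
  ultimately show ?thesis by (simp add: negligible_def)
qed

lemma negligible_short_root:
  assumes "j \<noteq> k" "j \<noteq> - k" "\<xi> \<in> \<sigma> j k"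
  shows "negligible i (short_root j k \<xi>)"
  using negligible_short[OF T_short_in_Ep_net[OF assms] minimal.T_short_in_Sp_net[OF assms], of i]
  by (simp add: T_short_eq)

text \<open>
  In the product of two short transvections the short roots themselves have negligible defect, and what is
  left is their product, a single matrix unit.
\<close>
lemma negligible_munit_via:
  assumes jhk: "j \<noteq> h" "j \<noteq> - h" "h \<noteq> k" "h \<noteq> - k" "j \<noteq> k" and "\<xi> \<in> \<sigma> j h" "\<zeta> \<in> \<sigma> h k"
  shows "negligible i (munit j k (\<xi> * \<zeta>))"
proof -
  let ?X = "short_root j h \<xi>" and ?Y = "short_root h k \<zeta>"
  have "negligible i (T_short j h \<xi> ** T_short h k \<zeta> - mat 1)"
    using assms by (intro negligible_short Ep_net_mult minimal.Sp_net_mult T_short_in_Ep_net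
        minimal.T_short_in_Sp_net)
  moreover have "negligible i ?X" "negligible i ?Y"
    by (intro negligible_short_root assms)+
  ultimately have "negligible i (T_short j h \<xi> ** T_short h k \<zeta> - mat 1 - ?X - ?Y)"
    by (blast intro: negligible_diff)
  moreover have "T_short j h \<xi> ** T_short h k \<zeta> - mat 1 - ?X - ?Y = munit j k (\<xi> * \<zeta>)"
    unfolding short_root_mult[OF jhk, symmetric] by (simp add: T_short_eq matrix_bilinear)
  ultimately show ?thesis by simp
qed

text \<open>
  Condition (T3). For a long transvection the two sums of \<open>transport_row_form\<close> each have one term: one is
  the element in question, and the other has been shown to be negligible by the detour via a neighbour of \<open>j\<close>.
\<close>
lemma Gamma_transport:
  assumes \<alpha>: "\<alpha> \<in> \<Gamma> j"
  shows "(a $ i $ j)\<^sup>2 * \<alpha> \<in> \<Gamma> i"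
proof -
  obtain h where h: "(j, h) \<in> \<nu>" "j \<noteq> h" "j \<noteq> - h" "h \<noteq> - j" by (rule class_neighbour)
  have "\<alpha> \<in> \<sigma> h (- j)"
    using sigma_class_left[OF \<nu>_sym[OF h(1)] Gamma_sigma[OF \<alpha>]] .
  then have "negligible i (munit j (- j) (1 * \<alpha>))"
    using h sigma_class[OF h(1)] by (intro negligible_munit_via[of j h]) auto
  then have "defect i (T_long j \<alpha> - mat 1) \<in> \<Gamma> i"
    by (simp add: T_long_def negligible_def)
  moreover have "(\<Sum>k\<in>UNIV. (a $ i $ k)\<^sup>2 * row_form (T_long j \<alpha>) k)
      = (\<Sum>k\<in>UNIV. if k = j then (a $ i $ j)\<^sup>2 * \<alpha> else 0)"
    by (intro sum.cong refl) (simp add: row_form_T_long)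
  ultimately show ?thesis
    using Gamma_diff[OF transport_row_form[OF T_long_in_Ep_net[OF \<alpha>], of i],
        of "defect i (T_long j \<alpha> - mat 1)"] by simp
qed

text \<open>
  Products of two short transvections produce the diagonal matrix units at \<open>j\<close> and \<open>- h\<close> only together. A
  product of three short transvections around the triangle \<open>j\<close>, \<open>h\<close>, \<open>h'\<close> contains a single diagonal
  matrix unit, and all its other terms are already known to be negligible.
\<close>
lemma negligible_diagonal:
  assumes "(j, - j) \<notin> \<nu>"
  shows "negligible i (munit j j \<xi>)"
proof -
  obtain h h' where h: "(j, h) \<in> \<nu>" "(j, h') \<in> \<nu>" "h \<noteq> j" "h \<noteq> - j" "h' \<noteq> j" "h' \<noteq> - j"
      "h \<noteq> h'" "h \<noteq> - h'"
    using assms by (rule class_triangle)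
  then have h': "j \<noteq> - h" "j \<noteq> - h'" "h' \<noteq> - h" by (metis uminus_uminus_idx)+
  have full: "x \<in> \<sigma> j h" "x \<in> \<sigma> h h'" "x \<in> \<sigma> h' j" "x \<in> \<sigma> (- h) (- j)" "x \<in> \<sigma> (- j) (- h')" for x
    using h(1,2) by (meson sigma_class \<nu>_sym \<nu>_trans \<nu>_uminus)+
  define c d where "c = eps j * eps h * \<xi>" and "d = eps h' * eps j * (1 :: 'r)"
  let ?U = "short_root j h \<xi>" and ?V = "short_root h h' 1" and ?W = "short_root h' j (1 :: 'r)"
  let ?\<tau> = "T_short j h \<xi> ** T_short h h' 1 ** T_short h' j 1"
  (* c and d are, up to signs that cancel in their product, the entries of the short roots in the
     negative half. *)
  have UV: "?U ** ?V = munit j h' \<xi>"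
    using short_root_mult[of j h h' \<xi> 1] h h' by simp
  have VW: "?V ** ?W = munit h j 1"
    using short_root_mult[of h h' j 1 1] h h' by simp
  have UW: "?U ** ?W = munit (- h) (- h') (c * d)"
    using h h' by (simp add: short_root_def matrix_bilinear munit_mult c_def d_def)
  have UVW: "?U ** ?V ** ?W = munit j j \<xi>"
    unfolding UV using h h' by (simp add: short_root_def matrix_bilinear munit_mult)
  have \<tau>: "?\<tau> - mat 1 = ?U + ?V + ?W + munit j h' (\<xi> * 1) + munit (- h) (- h') (c * d)
      + munit h j (1 * 1) + munit j j \<xi>"
    unfolding UVW[symmetric] UW[symmetric] by (simp add: UV[symmetric] VW[symmetric] T_short_eq matrix_bilinear add_ac)
  have "negligible i (?\<tau> - mat 1)"
    using h h' full by (intro negligible_short Ep_net_mult minimal.Sp_net_mult T_short_in_Ep_net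
        minimal.T_short_in_Sp_net) auto
  moreover have "negligible i (?U + ?V + ?W + munit j h' (\<xi> * 1) + munit (- h) (- h') (c * d)
      + munit h j (1 * 1))"
  proof (intro negligible_add)
    show "negligible i (munit j h' (\<xi> * 1))"
      using h h' full by (intro negligible_munit_via[of j h h']) auto
    show "negligible i (munit (- h) (- h') (c * d))"
      using h h' full by (intro negligible_munit_via[of "- h" "- j" "- h'"]) auto
    show "negligible i (munit h j (1 * 1))"
      using h h' full by (intro negligible_munit_via[of h h' j]) auto
  qed (use h h' full in \<open>auto intro!: negligible_short_root\<close>)
  ultimately have "negligible i ((?\<tau> - mat 1) - (?U + ?V + ?W + munit j h' (\<xi> * 1)
      + munit (- h) (- h') (c * d) + munit h j (1 * 1)))"
    by (rule negligible_diff)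
  then show ?thesis unfolding \<tau> by simp
qed

text \<open>
  Condition (T2). If \<open>j\<close> and \<open>- j\<close> are equivalent, then \<open>\<Gamma> j\<close> is the whole ring and (T3) suffices. Otherwise,
  off the diagonal, one of the two further members of the class of \<open>j\<close> is different from \<open>k\<close> and \<open>- k\<close> and can
  be used for a detour.
\<close>
lemma square_transport:
  assumes \<xi>: "\<xi> \<in> \<sigma> j k"
  shows "(a $ i $ j)\<^sup>2 * \<xi>\<^sup>2 * row_form b k \<in> \<Gamma> i"
proof (cases "(j, - j) \<in> \<nu>")
  case True
  show ?thesis
    using Gamma_transport[OF Gamma_class[OF True], of i "\<xi>\<^sup>2 * row_form b k"] by (simp add: mult.assoc)
next
  case False
  then obtain h h' where h: "(j, h) \<in> \<nu>" "(j, h') \<in> \<nu>" "h \<noteq> j" "h \<noteq> - j" "h' \<noteq> j" "h' \<noteq> - j"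
      "h \<noteq> h'" "h \<noteq> - h'"
    by (rule class_triangle)
  show ?thesis
  proof (cases "k = j")
    case True
    then show ?thesis using negligible_munitD[OF negligible_diagonal[OF False]] by simp
  next
    case neq: False
    have "\<exists>g. (j, g) \<in> \<nu> \<and> g \<noteq> j \<and> g \<noteq> - j \<and> g \<noteq> k \<and> g \<noteq> - k"
    proof (cases "h = k \<or> h = - k")
      case True
      then have "h' \<noteq> k \<and> h' \<noteq> - k" using h(7,8) by auto
      then show ?thesis using h by blast
    next
      case False
      then show ?thesis using h by blast
    qed
    then obtain g where g: "(j, g) \<in> \<nu>" "g \<noteq> j" "g \<noteq> - j" "g \<noteq> k" "g \<noteq> - k" by blast
    then have "j \<noteq> - g" by (metis uminus_uminus_idx)
    then have "negligible i (munit j k (1 * \<xi>))"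
      using g neq sigma_class[OF g(1)] sigma_class_left[OF \<nu>_sym[OF g(1)] \<xi>]
      by (intro negligible_munit_via[of j g k]) auto
    then show ?thesis using negligible_munitD[of i j k \<xi>] by simp
  qed
qed

end

section \<open>The normalizer\<close>

context unitary_form_D_net
begin

text \<open>
  The conditions (T1), (T2), (T3), with \<open>row_form\<close> in place of \<open>S_len\<close>.
\<close>
definition transport_conditions :: "('r, 'n) sqmat \<Rightarrow> bool" where
  "transport_conditions a \<longleftrightarrow>
    (\<forall>i j k l. \<forall>\<xi>\<in>\<sigma> j k. a $ i $ j * \<xi> * matrix_inv a $ k $ l \<in> \<sigma> i l) \<and>
    (\<forall>i j k. \<forall>\<xi>\<in>\<sigma> j k. (a $ i $ j)\<^sup>2 * \<xi>\<^sup>2 * row_form (matrix_inv a) k \<in> \<Gamma> i) \<and>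
    (\<forall>i j. \<forall>\<alpha>\<in>\<Gamma> j. (a $ i $ j)\<^sup>2 * \<alpha> \<in> \<Gamma> i)"

lemma transport_conditionsD:
  assumes "transport_conditions a"
  shows "\<xi> \<in> \<sigma> j k \<Longrightarrow> a $ i $ j * \<xi> * matrix_inv a $ k $ l \<in> \<sigma> i l"
    and "\<xi> \<in> \<sigma> j k \<Longrightarrow> (a $ i $ j)\<^sup>2 * \<xi>\<^sup>2 * row_form (matrix_inv a) k \<in> \<Gamma> i"
    and "\<alpha> \<in> \<Gamma> j \<Longrightarrow> (a $ i $ j)\<^sup>2 * \<alpha> \<in> \<Gamma> i"
  using assms by (auto simp: transport_conditions_def)

lemma transport_conditions_conj:
  assumes "a \<in> Sp_carrier" "transport_conditions a" "\<tau> \<in> Sp_net (\<sigma>, \<Gamma>)"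
  shows "a ** \<tau> ** matrix_inv a \<in> Sp_net (\<sigma>, \<Gamma>)"
proof -
  note D = transport_conditionsD[OF assms(2)]
  interpret net_conjugator \<sigma> \<Gamma> a
    by unfold_locales (rule assms(1), rule D(1))
  show ?thesis by (rule conj_in_Sp_net[OF D(2,3) assms(3)])
qed

text \<open>
  The second condition for the inverse is the statement that the values of \<open>row_form\<close> on the rows of \<open>a\<close> lie in \<open>\<Gamma>\<close>, combined
  with the third condition for the inverse.
\<close>
lemma transport_conditions_inverse:
  assumes "a \<in> Sp_carrier" "transport_conditions a"
  shows "transport_conditions (matrix_inv a)"
proof -
  note D = transport_conditionsD[OF assms(2)]
  interpret net_conjugator \<sigma> \<Gamma> a
    by unfold_locales (rule assms(1), rule D(1))
  interpret inv: net_conjugator \<sigma> \<Gamma> "matrix_inv a" by (rule inverse_net_conjugator)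
  have T3: "(b $ i $ j)\<^sup>2 * \<alpha> \<in> \<Gamma> i" if "\<alpha> \<in> \<Gamma> j" for i j \<alpha>
    by (rule inverse_T3[OF D(3) that])
  have "(b $ i $ j)\<^sup>2 * \<xi>\<^sup>2 * row_form a k \<in> \<Gamma> i" if "\<xi> \<in> \<sigma> j k" for i j k \<xi>
    using T3[OF Gamma_square[OF that row_form_in_Gamma[OF D(2)]], of i] by (simp add: mult.assoc)
  then show ?thesis
    using T3 inv.conj_sigma by (auto simp: transport_conditions_def matrix_inv_in_Sp(2)[OF assms(1)])
qed

lemma transporter_Sp:
  "transporter Sp A B = {a \<in> Sp_carrier. \<forall>\<tau>\<in>A. a ** \<tau> ** matrix_inv a \<in> B}"
  by (auto simp: transporter_def inv_Sp)

lemma normalizer_Sp_net: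
  "normalizer Sp (Sp_net (\<sigma>, \<Gamma>)) =
    {a \<in> Sp_carrier. (\<lambda>\<tau>. a ** \<tau> ** matrix_inv a) ` Sp_net (\<sigma>, \<Gamma>) = Sp_net (\<sigma>, \<Gamma>)}"
proof -
  have coset: "a <#\<^bsub>Sp\<^esub> H #>\<^bsub>Sp\<^esub> inv\<^bsub>Sp\<^esub> a = (\<lambda>\<tau>. a ** \<tau> ** matrix_inv a) ` H"
    if "a \<in> Sp_carrier" for a :: "('r, 'n) sqmat" and H
    using that by (auto simp: l_coset_def r_coset_def inv_Sp)
  have sub: "Sp_net (\<sigma>, \<Gamma>) \<subseteq> Sp_carrier" by (auto simp: Sp_net_carrier)
  show ?thesis
    unfolding normalizer_def stabilizer_def
    by (rule Collect_cong) (simp add: coset sub cong: conj_cong)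
qed

lemma normalizer_if_transport_conditions:
  assumes a: "a \<in> Sp_carrier" and T: "transport_conditions a"
  shows "a \<in> normalizer Sp (Sp_net (\<sigma>, \<Gamma>))"
proof -
  note D = Sp_carrierD[OF a]
  have "\<tau> \<in> (\<lambda>\<tau>. a ** \<tau> ** matrix_inv a) ` Sp_net (\<sigma>, \<Gamma>)" if "\<tau> \<in> Sp_net (\<sigma>, \<Gamma>)" for \<tau>
  proof (rule image_eqI)
    show "matrix_inv a ** \<tau> ** a \<in> Sp_net (\<sigma>, \<Gamma>)"
      using transport_conditions_conj[OF matrix_inv_in_Sp(1)[OF a] transport_conditions_inverse[OF a T] that]
      by (simp add: matrix_inv_in_Sp(2)[OF a])
    have "a ** (matrix_inv a ** \<tau> ** a) ** matrix_inv a
        = (a ** matrix_inv a) ** \<tau> ** (a ** matrix_inv a)"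
      by (simp only: matrix_mul_assoc)
    then show "\<tau> = a ** (matrix_inv a ** \<tau> ** a) ** matrix_inv a"
      by (simp add: D)
  qed
  then show ?thesis
    using transport_conditions_conj[OF a T] a by (auto simp: normalizer_Sp_net)
qed

end

lemma (in class_net) transport_conditions_if_transporter:
  assumes "a \<in> Sp_carrier" "\<And>\<tau>. \<tau> \<in> Ep_net (\<sigma>, \<Gamma>) \<Longrightarrow> a ** \<tau> ** matrix_inv a \<in> Sp_net (\<sigma>, \<Gamma>)"
  shows "transport_conditions a"
proof -
  interpret net_transporter \<sigma> \<Gamma> \<nu> a
    by unfold_locales (rule assms(1), rule assms(2))
  show ?thesis
    using conj_sigma square_transport Gamma_transport by (auto simp: transport_conditions_def)
qed

theorem theorem2:
  fixes \<nu> :: "('n::finite idx \<times> 'n idx) set"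
    and \<sigma> :: "'n idx \<Rightarrow> 'n idx \<Rightarrow> 'r::comm_ring_1 set"
    and \<Gamma> :: "'n idx \<Rightarrow> 'r set"
  assumes "equiv UNIV \<nu>"
    and "unitary_rel \<nu>"
    and "\<forall>C \<in> UNIV // \<nu>. 3 \<le> card C"
    and "unitary_exact_form_D_net (\<sigma>, \<Gamma>)"
    and "form_net_le (rel_form_net \<nu>) (\<sigma>, \<Gamma>)"
  shows "normalizer Sp (Sp_net (\<sigma>, \<Gamma>)) = transporter Sp (Ep_net (\<sigma>, \<Gamma>)) (Sp_net (\<sigma>, \<Gamma>)) \<and>
    transporter Sp (Ep_net (\<sigma>, \<Gamma>)) (Sp_net (\<sigma>, \<Gamma>)) =
      {a \<in> carrier Sp.
        (\<forall>i j k l. \<forall>\<xi>\<in>\<sigma> j k. a $ i $ j * \<xi> * matrix_inv a $ k $ l \<in> \<sigma> i l) \<and>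
        (\<forall>i j k. \<forall>\<xi>\<in>\<sigma> j k. (a $ i $ j)\<^sup>2 * \<xi>\<^sup>2 * S_len k (matrix_inv a) \<in> \<Gamma> i) \<and>
        (\<forall>i j. \<forall>\<alpha>\<in>\<Gamma> j. (a $ i $ j)\<^sup>2 * \<alpha> \<in> \<Gamma> i)}"
proof -
  interpret class_net \<sigma> \<Gamma> \<nu>
    using assms by unfold_locales (auto simp: unitary_exact_form_D_net_def exact_form_net_def)
  let ?N = "normalizer Sp (Sp_net (\<sigma>, \<Gamma>))"
  let ?T = "transporter Sp (Ep_net (\<sigma>, \<Gamma>)) (Sp_net (\<sigma>, \<Gamma>))"
  let ?C = "{a \<in> Sp_carrier. transport_conditions a}"
  have "?C \<subseteq> ?N"
    by (auto intro: normalizer_if_transport_conditions)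
  moreover have "?N \<subseteq> ?T"
    using Ep_net_subset unfolding normalizer_Sp_net transporter_Sp by blast
  moreover have "?T \<subseteq> ?C"
    by (auto simp: transporter_Sp intro: transport_conditions_if_transporter)
  ultimately have "?N = ?T" "?T = ?C" by blast+
  moreover have "?C = {a \<in> carrier Sp.
        (\<forall>i j k l. \<forall>\<xi>\<in>\<sigma> j k. a $ i $ j * \<xi> * matrix_inv a $ k $ l \<in> \<sigma> i l) \<and>
        (\<forall>i j k. \<forall>\<xi>\<in>\<sigma> j k. (a $ i $ j)\<^sup>2 * \<xi>\<^sup>2 * S_len k (matrix_inv a) \<in> \<Gamma> i) \<and>
        (\<forall>i j. \<forall>\<alpha>\<in>\<Gamma> j. (a $ i $ j)\<^sup>2 * \<alpha> \<in> \<Gamma> i)}"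
    by (rule Collect_cong)
      (simp add: transport_conditions_def mult_S_len_iff[OF matrix_inv_in_Sp(1)] cong: conj_cong)
  ultimately show ?thesis by (simp only:)
qed

end
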